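(* Let $\sigma=(\sigma(x))_{x\in\mathsf{SG}}$ be an i.i.d. divisible sandpile on the doubly-infinite Sierpiński gasket graph $\mathsf{SG}$, i.e. a family of i.i.d. real-valued random variables, such that $\mathbb{E}[\sigma(o)]\ge 1$ and $0<\mathrm{Var}[\sigma(o)]<\infty$, where $o=(0,0)$. Then almost surely $\sigma$ does not stabilize.
   Context: **The graph $\mathsf{SG}$.** In $\mathbb{R}^2$ let $V_0=\{(0,0),(1,0),(1/2,\sqrt3/2)\}$ and let $E_0$ be the set of the three (undirected) edges joining pairs of distinct points of $V_0$. For $n\ge 0$ define recursively $$V_{n+1}=V_n\cup\big((2^n,0)+V_n\big)\cup\big((2^{n-1},2^{n-1}\sqrt3)+V_n\big),\qquad E_{n+1}=E_n\cup\big((2^n,0)+E_n\big)\cup\big((2^{n-1},2^{n-1}\sqrt3)+E_n\big),$$ where translations act on edges through their endpoints. Let $V_n',E_n'$ be the reflections of $V_n,E_n$ under $(x,y)\mapsto(-x,y)$. Let $\mathsf{SG}_n$ be the finite graph with vertex set $V_n\cup V_n'$ and edge set $E_n\cup E_n'$, and let $\mathsf{SG}=\bigcup_n\mathsf{SG}_n$ (union of vertex sets and of edge sets). Every vertex of $\mathsf{SG}$ has degree $4$. "$x\in\mathsf{SG}$" means that $x$ is a vertex of $\mathsf{SG}$. **Divisible sandpiles and stabilization.** A divisible sandpile is a function $\sigma:\mathsf{SG}\to\mathbb{R}$, giving the amount of mass at each vertex. A vertex $x$ is unstable if $\sigma(x)>1$; it topples by keeping mass $1$ and distributing the excess $\sigma(x)-1$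 equally among its four neighbours. For each $n$, $\sigma$ is stabilized on $\mathsf{SG}_n$ by toppling unstable vertices of $\mathsf{SG}_n$ (each vertex being considered infinitely often), where mass sent outside $\mathsf{SG}_n$ is collected by the outer boundary, acting as sink, and vertices outside $\mathsf{SG}_n$ never topple. The odometer $u_n(x)$ is the total mass emitted from $x$ during this stabilization, with $u_n(x)=0$ for $x\notin\mathsf{SG}_n$; it does not depend on the order of topplings. Equivalently, $u_n$ is the smallest function $u:\mathsf{SG}\to[0,\infty)$ vanishing outside $\mathsf{SG}_n$ with $\sigma(x)-\Delta u(x)\le 1$ for all $x\in\mathsf{SG}_n$, where $\Delta u(x)=u(x)-\frac14\sum_{y\sim x}u(y)$. The functions $u_n$ are nondecreasing in $n$; let $u^\infty(x)=\lim_{n\to\infty}u_n(x)\in[0,\infty]$. The divisible sandpile $\sigma$ stabilizes if $u^\infty(x)<\infty$ for all $x\in\mathsf{SG}$; otherwise it does not stabilize. *)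

theory Defs
  imports "HOL-Probability.Probability"
begin

section \<open>The doubly-infinite Sierpinski gasket graph\<close>

type_synonym point = "real \<times> real"

definition reflect :: "point \<Rightarrow> point" where
  "reflect p = (- fst p, snd p)"

text \<open>Undirected edges are two-element sets of points, so that the translations and the reflection
  act on them by taking images.\<close>

fun V :: "nat \<Rightarrow> point set" where
  "V 0 = {(0, 0), (1, 0), (1/2, sqrt 3 / 2)}"
| "V (Suc n) = V n \<union> (+) (2^n, 0) ` V n \<union> (+) (2^n / 2, 2^n / 2 * sqrt 3) ` V n"

fun E :: "nat \<Rightarrow> point set set" where
  "E 0 = {{p, q} | p q. p \<in> V 0 \<and> q \<in> V 0 \<and> p \<noteq> q}"
| "E (Suc n) = E n \<union> (`) ((+) (2^n, 0)) ` E n \<union> (`) ((+) (2^n / 2, 2^n / 2 * sqrt 3)) ` E n"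

definition SG_verts_upto :: "nat \<Rightarrow> point set" where
  "SG_verts_upto n = V n \<union> reflect ` V n"

definition SG_edges_upto :: "nat \<Rightarrow> point set set" where
  "SG_edges_upto n = E n \<union> (`) reflect ` E n"

definition SG_verts :: "point set" where
  "SG_verts = (\<Union>n. SG_verts_upto n)"

definition SG_edges :: "point set set" where
  "SG_edges = (\<Union>n. SG_edges_upto n)"


section \<open>Divisible sandpiles\<close>

text \<open>Sandpiles are total functions on points; toppling vertices of the gasket neither reads nor
  changes the values at points that are not vertices. Every vertex of the gasket has degree 4.\<close>

type_synonym sandpile = "point \<Rightarrow> real"

definition topple :: "point \<Rightarrow> sandpile \<Rightarrow> sandpile" where
  "topple x \<eta> =
     (if \<eta> x > 1
      then (\<lambda>z. if z = x then 1
                else if {x, z} \<in> SG_edges then \<eta> z + (\<eta> x - 1) / 4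
                else \<eta> z)
      else \<eta>)"

text \<open>A toppling order for stage \<open>n\<close> considers only vertices of the \<open>n\<close>-th finite gasket, each of
  them infinitely often. Since points outside never topple, they act as the sink.\<close>

definition toppling_order :: "nat \<Rightarrow> (nat \<Rightarrow> point) \<Rightarrow> bool" where
  "toppling_order n s \<longleftrightarrow>
     range s \<subseteq> SG_verts_upto n \<and> (\<forall>x\<in>SG_verts_upto n. \<exists>\<^sub>\<infinity>k. s k = x)"

fun config :: "(nat \<Rightarrow> point) \<Rightarrow> sandpile \<Rightarrow> nat \<Rightarrow> sandpile" where
  "config s \<sigma> 0 = \<sigma>"
| "config s \<sigma> (Suc k) = topple (s k) (config s \<sigma> k)"

definition emitted :: "(nat \<Rightarrow> point) \<Rightarrow> sandpile \<Rightarrow> nat \<Rightarrow> point \<Rightarrow> real" where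
  "emitted s \<sigma> k x = (\<Sum>j | j < k \<and> s j = x. max 0 (config s \<sigma> j x - 1))"

text \<open>The total mass emitted is the same for all toppling orders, so the definite description is
  meaningful: see \<open>emitted_tendsto_odometer\<close> below.\<close>

definition odometer :: "sandpile \<Rightarrow> nat \<Rightarrow> point \<Rightarrow> ennreal" where
  "odometer \<sigma> n x =
     (THE c. \<forall>s. toppling_order n s \<longrightarrow> (\<lambda>k. ennreal (emitted s \<sigma> k x)) \<longlonglongrightarrow> c)"

definition odometer_infinity :: "sandpile \<Rightarrow> point \<Rightarrow> ennreal" where
  "odometer_infinity \<sigma> x = lim (\<lambda>n. odometer \<sigma> n x)"

definition stabilizes :: "sandpile \<Rightarrow> bool" where
  "stabilizes \<sigma> \<longleftrightarrow> (\<forall>x\<in>SG_verts. odometer_infinity \<sigma> x < \<infinity>)"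


section \<open>The odometers are well defined and monotone\<close>

lemma emitted_0 [simp]: "emitted s \<sigma> 0 x = 0"
  by (simp add: emitted_def)

lemma emitted_Suc:
  "emitted s \<sigma> (Suc k) x =
     emitted s \<sigma> k x + (if s k = x then max 0 (config s \<sigma> k x - 1) else 0)"
proof (cases "s k = x")
  case True
  have "{j. j < Suc k \<and> s j = x} = insert k {j. j < k \<and> s j = x}"
    using True by (auto simp: less_Suc_eq)
  then show ?thesis
    using True by (simp add: emitted_def)
next
  case False
  have "{j. j < Suc k \<and> s j = x} = {j. j < k \<and> s j = x}"
    using False by (auto simp: less_Suc_eq)
  then show ?thesis
    using False by (simp add: emitted_def)
qed

lemma emitted_mono: "j \<le> k \<Longrightarrow> emitted s \<sigma> j x \<le> emitted s \<sigma> k x"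
  by (rule lift_Suc_mono_le) (simp_all add: emitted_Suc)

lemma emitted_nonneg: "0 \<le> emitted s \<sigma> k x"
  using emitted_mono[of 0 k s \<sigma> x] by simp

lemma emitted_eq_0: "x \<notin> s ` {..<k} \<Longrightarrow> emitted s \<sigma> k x = 0"
  unfolding emitted_def by (rule sum.neutral) auto

abbreviation nbrs :: "point \<Rightarrow> point set" where
  "nbrs x \<equiv> {y. y \<noteq> x \<and> {y, x} \<in> SG_edges}"

lemma config_eq:
  assumes "finite F" "F \<subseteq> nbrs x" "s ` {..<k} \<inter> nbrs x \<subseteq> F"
  shows "config s \<sigma> k x = \<sigma> x - emitted s \<sigma> k x + (\<Sum>y\<in>F. emitted s \<sigma> k y) / 4"
  using assms(3)
proof (induction k)
  case 0
  then show ?case by simp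
next
  case (Suc k)
  let ?m = "max 0 (config s \<sigma> k (s k) - 1)"
  have IH: "config s \<sigma> k x = \<sigma> x - emitted s \<sigma> k x + (\<Sum>y\<in>F. emitted s \<sigma> k y) / 4"
    using Suc by (auto simp: lessThan_Suc)
  have sum: "(\<Sum>y\<in>F. emitted s \<sigma> (Suc k) y) =
      (\<Sum>y\<in>F. emitted s \<sigma> k y) + (if s k \<in> F then ?m else 0)"
  proof -
    have "(\<Sum>y\<in>F. emitted s \<sigma> (Suc k) y) =
        (\<Sum>y\<in>F. emitted s \<sigma> k y + (if s k = y then ?m else 0))"
      by (rule sum.cong) (auto simp: emitted_Suc)
    also have "\<dots> = (\<Sum>y\<in>F. emitted s \<sigma> k y) + (if s k \<in> F then ?m else 0)"
      using assms(1) by (simp add: sum.distrib)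
    finally show ?thesis .
  qed
  have inF: "s k \<in> F \<longleftrightarrow> s k \<noteq> x \<and> {s k, x} \<in> SG_edges"
    using assms(2) Suc.prems by (auto simp: lessThan_Suc)
  consider "s k = x" | "s k \<noteq> x" "s k \<in> F" | "s k \<noteq> x" "s k \<notin> F" by blast
  then show ?case
  proof cases
    case 1
    then have "s k \<notin> F" using inF by simp
    with 1 show ?thesis
      unfolding sum using IH by (auto simp: emitted_Suc topple_def max_def)
  next
    case 2
    then have "{s k, x} \<in> SG_edges" using inF by simp
    with 2 show ?thesis
      unfolding sum using IH by (auto simp: emitted_Suc topple_def max_def add_divide_distrib)
  next
    case 3
    then have "{s k, x} \<notin> SG_edges" using inF by simp
    with 3 show ?thesis
      unfolding sum using IH by (auto simp: emitted_Suc topple_def)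
  qed
qed

lemma config_ge:
  assumes "finite F" "F \<subseteq> nbrs x"
  shows "config s \<sigma> k x \<ge> \<sigma> x - emitted s \<sigma> k x + (\<Sum>y\<in>F. emitted s \<sigma> k y) / 4"
proof -
  let ?G = "F \<union> (s ` {..<k} \<inter> nbrs x)"
  have "config s \<sigma> k x = \<sigma> x - emitted s \<sigma> k x + (\<Sum>y\<in>?G. emitted s \<sigma> k y) / 4"
    by (rule config_eq) (use assms in auto)
  moreover have "(\<Sum>y\<in>F. emitted s \<sigma> k y) \<le> (\<Sum>y\<in>?G. emitted s \<sigma> k y)"
    by (rule sum_mono2) (use assms in \<open>auto simp: emitted_nonneg\<close>)
  ultimately show ?thesis by simp
qed

lemma emitted_dominated:
  assumes s: "range s \<subseteq> A" and s': "\<And>x. x \<in> A \<Longrightarrow> \<exists>\<^sub>\<infinity>k. s' k = x" and "\<epsilon> > 0"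
  shows "\<exists>j. emitted s \<sigma> k x - \<epsilon> \<le> emitted s' \<sigma> j x"
  using \<open>\<epsilon> > 0\<close>
proof (induction k arbitrary: x \<epsilon>)
  case 0
  then show ?case using emitted_nonneg[of s' \<sigma> 0 x] by (auto intro!: exI[of _ 0])
next
  case (Suc k)
  show ?case
  proof (cases "s k = x \<and> config s \<sigma> k x > 1")
    case False
    then have "emitted s \<sigma> (Suc k) x = emitted s \<sigma> k x" by (auto simp: emitted_Suc)
    then show ?thesis using Suc by simp
  next
    case True
    define F where "F = s ` {..<k} \<inter> nbrs x"
    define \<delta> where "\<delta> = \<epsilon> / (card F + 1)"
    have F: "finite F" "F \<subseteq> nbrs x" by (auto simp: F_def)
    have \<delta>: "\<delta> > 0" using Suc.prems by (simp add: \<delta>_def add_nonneg_pos)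
    have "\<forall>y. \<exists>j. emitted s \<sigma> k y - \<delta> \<le> emitted s' \<sigma> j y" using Suc.IH[OF \<delta>] by blast
    then obtain j where j: "\<And>y. emitted s \<sigma> k y - \<delta> \<le> emitted s' \<sigma> (j y) y" by metis
    define J where "J = Max (insert 0 (j ` F))"
    have J: "j y \<le> J" if "y \<in> F" for y
      unfolding J_def by (rule Max_ge) (use that F in auto)
    have "x \<in> A" using s True by auto
    from s'[OF this] obtain i where i: "i \<ge> J" "s' i = x"
      unfolding INFM_nat_le by blast
    have le: "emitted s \<sigma> k y - \<delta> \<le> emitted s' \<sigma> i y" if "y \<in> F" for y
      using j[of y] emitted_mono[of "j y" i s' \<sigma> y] J[OF that] i by linarith
    have "(\<Sum>y\<in>F. emitted s \<sigma> k y - \<delta>) \<le> (\<Sum>y\<in>F. emitted s' \<sigma> i y)"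
      by (rule sum_mono) (rule le)
    then have sums: "(\<Sum>y\<in>F. emitted s \<sigma> k y) - card F * \<delta> \<le> (\<Sum>y\<in>F. emitted s' \<sigma> i y)"
      by (simp add: sum_subtractf)
    have "card F * \<delta> \<le> \<epsilon>"
      using Suc.prems by (simp add: \<delta>_def field_simps)
    moreover have "emitted s \<sigma> (Suc k) x = \<sigma> x - 1 + (\<Sum>y\<in>F. emitted s \<sigma> k y) / 4"
      using True config_eq[OF F, of s k \<sigma>] by (simp add: emitted_Suc F_def)
    moreover have "emitted s' \<sigma> (Suc i) x \<ge> \<sigma> x - 1 + (\<Sum>y\<in>F. emitted s' \<sigma> i y) / 4"
      using config_ge[OF F, of \<sigma> s' i] i by (simp add: emitted_Suc)
    ultimately have "emitted s \<sigma> (Suc k) x - \<epsilon> \<le> emitted s' \<sigma> (Suc i) x"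
      using sums Suc.prems by linarith
    then show ?thesis by blast
  qed
qed

lemma finite_V: "finite (V n)" and V_nonempty: "V n \<noteq> {}"
  by (induction n) auto

lemma finite_SG_verts_upto: "finite (SG_verts_upto n)"
  by (simp add: SG_verts_upto_def finite_V)

lemma SG_verts_upto_mono: "m \<le> n \<Longrightarrow> SG_verts_upto m \<subseteq> SG_verts_upto n"
  by (rule lift_Suc_mono_le) (auto simp: SG_verts_upto_def)

lemma toppling_order_exists: "\<exists>s. toppling_order n s"
proof -
  let ?A = "SG_verts_upto n"
  let ?N = "card ?A"
  have fin: "finite ?A" by (rule finite_SG_verts_upto)
  have "?A \<noteq> {}" using V_nonempty by (auto simp: SG_verts_upto_def)
  with fin have N: "?N > 0" by (simp add: card_gt_0_iff)
  obtain f where f: "bij_betw f {0..<?N} ?A"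
    using ex_bij_betw_nat_finite[OF fin] by blast
  define s where "s k = f (k mod ?N)" for k
  have "s k \<in> ?A" for k
    using f N unfolding s_def bij_betw_def by auto
  moreover have "\<exists>\<^sub>\<infinity>k. s k = x" if "x \<in> ?A" for x
  proof -
    have "x \<in> f ` {0..<?N}" using f that by (simp add: bij_betw_def)
    then obtain i where i: "i < ?N" "f i = x" by (elim imageE) simp
    have "\<exists>k\<ge>m. s k = x" for m
    proof (intro exI conjI)
      show "i + m * ?N \<ge> m" using N by (cases ?N) auto
      show "s (i + m * ?N) = x" using i by (simp add: s_def)
    qed
    then show ?thesis unfolding INFM_nat_le by blast
  qed
  ultimately have "toppling_order n s" by (auto simp: toppling_order_def)
  then show ?thesis by blast
qed

lemma SUP_emitted_mono:
  assumes "toppling_order m s" "toppling_order n s'" "m \<le> n"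
  shows "(SUP k. ennreal (emitted s \<sigma> k x)) \<le> (SUP k. ennreal (emitted s' \<sigma> k x))"
proof (rule SUP_least)
  fix k
  show "ennreal (emitted s \<sigma> k x) \<le> (SUP k. ennreal (emitted s' \<sigma> k x))"
  proof (rule ennreal_le_epsilon)
    fix e :: real assume e: "0 < e"
    have "\<exists>j. emitted s \<sigma> k x - e \<le> emitted s' \<sigma> j x"
      by (rule emitted_dominated[OF _ _ e, where A = "SG_verts_upto m"])
        (use assms SG_verts_upto_mono[OF assms(3)] in \<open>auto simp: toppling_order_def\<close>)
    then obtain j where "emitted s \<sigma> k x \<le> emitted s' \<sigma> j x + e"
      by (auto simp: algebra_simps)
    then have "ennreal (emitted s \<sigma> k x) \<le> ennreal (emitted s' \<sigma> j x + e)"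
      by (rule ennreal_leI)
    also have "\<dots> = ennreal (emitted s' \<sigma> j x) + ennreal e"
      using e by (simp add: emitted_nonneg)
    also have "\<dots> \<le> (SUP k. ennreal (emitted s' \<sigma> k x)) + ennreal e"
      by (intro add_right_mono SUP_upper) simp
    finally show "ennreal (emitted s \<sigma> k x) \<le> (SUP k. ennreal (emitted s' \<sigma> k x)) + ennreal e" .
  qed
qed

lemma emitted_tendsto_SUP:
  "(\<lambda>k. ennreal (emitted s \<sigma> k x)) \<longlonglongrightarrow> (SUP k. ennreal (emitted s \<sigma> k x))"
  by (rule LIMSEQ_SUP) (auto intro!: monoI ennreal_leI emitted_mono)

lemma odometer_eq_SUP:
  assumes "toppling_order n s"
  shows "odometer \<sigma> n x = (SUP k. ennreal (emitted s \<sigma> k x))"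
  unfolding odometer_def
proof (rule the_equality)
  show "\<forall>s'. toppling_order n s' \<longrightarrow>
      (\<lambda>k. ennreal (emitted s' \<sigma> k x)) \<longlonglongrightarrow> (SUP k. ennreal (emitted s \<sigma> k x))"
    using SUP_emitted_mono[OF assms _ order_refl] SUP_emitted_mono[OF _ assms order_refl]
      emitted_tendsto_SUP by (metis order_antisym)
next
  fix c
  assume "\<forall>s'. toppling_order n s' \<longrightarrow> (\<lambda>k. ennreal (emitted s' \<sigma> k x)) \<longlonglongrightarrow> c"
  with assms show "c = (SUP k. ennreal (emitted s \<sigma> k x))"
    using emitted_tendsto_SUP LIMSEQ_unique by blast
qed

theorem emitted_tendsto_odometer:
  "toppling_order n s \<Longrightarrow> (\<lambda>k. ennreal (emitted s \<sigma> k x)) \<longlonglongrightarrow> odometer \<sigma> n x"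
  by (simp add: odometer_eq_SUP emitted_tendsto_SUP)

lemma odometer_outside: "x \<notin> SG_verts_upto n \<Longrightarrow> odometer \<sigma> n x = 0"
proof -
  assume x: "x \<notin> SG_verts_upto n"
  obtain s where s: "toppling_order n s" using toppling_order_exists by blast
  then have "x \<notin> s ` {..<k}" for k using x by (auto simp: toppling_order_def)
  then show ?thesis by (simp add: odometer_eq_SUP[OF s] emitted_eq_0)
qed

theorem odometer_mono: "m \<le> n \<Longrightarrow> odometer \<sigma> m x \<le> odometer \<sigma> n x"
  using SUP_emitted_mono toppling_order_exists odometer_eq_SUP by metis

theorem odometer_tendsto_infinity: "(\<lambda>n. odometer \<sigma> n x) \<longlonglongrightarrow> odometer_infinity \<sigma> x"
proof -
  have "(\<lambda>n. odometer \<sigma> n x) \<longlonglongrightarrow> (SUP n. odometer \<sigma> n x)"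
    by (rule LIMSEQ_SUP) (auto intro!: monoI odometer_mono)
  then show ?thesis by (simp add: odometer_infinity_def limI)
qed

end

theory Submission
  imports Defs
begin

text \<open>Suppose that \<open>\<sigma>\<close> stabilizes, and let \<open>u\<close> be its finite limiting odometer. Every vertex topples
  until at most mass 1 is left, so \<open>\<Delta>u \<ge> \<sigma> - 1\<close> at every vertex. The idea is to test this inequality
  against the harmonic functions \<open>h\<^sub>n\<close> on the level \<open>n\<close> triangle with value 1 at the origin and 0 at the two
  other corners. They are nonnegative, so by Green's identity \<open>\<Sum>x. h\<^sub>n x * (\<sigma> x - 1)\<close> is at most a
  boundary term; at the far corners the boundary term is nonpositive, and at the origin it involves only
  the values of \<open>u\<close> at two neighbours. Hence these sums are bounded in \<open>n\<close> (lemma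
  \<open>green_from_origin\<close>). The harmonic functions are explicit, because the gasket is self-similar and
  finitely ramified, and Green's identity follows by induction on the level.

  On the other hand the sums are weighted sums of independent variables of nonnegative mean and equal
  positive variance. The weights lie between 0 and 1, and their squares have an unbounded sum: \<open>h\<^sub>n\<close> is at
  least 2/5 on the level \<open>n - 1\<close> triangle at the origin. Such sums are almost surely unbounded above
  (lemma \<open>weighted_sums_unbounded\<close>), which is the contradiction. The reason is an anti-concentration
  bound: with a probability that does not depend on the weights, a weighted sum exceeds a fixed
  multiple of its standard deviation (lemma \<open>prob_large_sum\<close>); new vertices give infinitely many
  almost independent chances for this to happen.\<close>

section \<open>Weighted sums of independent identically distributed variables\<close>

text \<open>A centred variable has half of its absolute moment on the positive side. If it were rarely large
  there, the second moment would have to pay for that half. The weight \<open>l\<close> in the inequality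
  \<open>2 s \<le> l s\<^sup>2 + 1 / l\<close> is chosen so that the second moment accounts for half of
  the mean of the positive part above the level \<open>\<eta> / 4\<close>.\<close>

lemma (in prob_space) prob_ge_of_abs_moment:
  fixes S :: "'a \<Rightarrow> real"
  assumes S: "integrable M S" "integrable M (\<lambda>\<omega>. (S \<omega>)\<^sup>2)"
    and mean: "expectation S = 0"
    and v: "expectation (\<lambda>\<omega>. (S \<omega>)\<^sup>2) = v" "v > 0"
    and \<eta>: "0 < \<eta>" "\<eta> \<le> expectation (\<lambda>\<omega>. \<bar>S \<omega>\<bar>)"
  shows "\<eta>\<^sup>2 / (16 * v) \<le> prob {\<omega> \<in> space M. \<eta> / 4 \<le> S \<omega>}"
proof -
  define A where "A = {\<omega> \<in> space M. \<eta> / 4 \<le> S \<omega>}"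
  define l where "l = \<eta> / (4 * v)"
  have l: "l > 0" using \<eta> v by (simp add: l_def)
  have [measurable]: "S \<in> borel_measurable M" using S by auto
  have [measurable]: "A \<in> sets M" unfolding A_def by measurable
  have indicator: "integrable M (indicator A :: 'a \<Rightarrow> real)"
    by (rule integrable_real_indicator) (auto simp: emeasure_eq_measure)
  have "expectation (\<lambda>\<omega>. (\<bar>S \<omega>\<bar> + S \<omega>) / 2) \<le>
      expectation (\<lambda>\<omega>. \<eta> / 4 + (l / 2 * (S \<omega>)\<^sup>2 + 1 / (2 * l) * indicator A \<omega>))"
  proof (rule integral_mono)
    fix \<omega> assume \<omega>: "\<omega> \<in> space M"
    have "0 \<le> (l * S \<omega> - 1)\<^sup>2 / (2 * l)" using l by simp
    also have "\<dots> = l / 2 * (S \<omega>)\<^sup>2 + 1 / (2 * l) - S \<omega>"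
      using l by (simp add: power2_eq_square field_simps)
    finally have amgm: "S \<omega> \<le> l / 2 * (S \<omega>)\<^sup>2 + 1 / (2 * l)" by simp
    have "0 \<le> l / 2 * (S \<omega>)\<^sup>2" using l by simp
    then show "(\<bar>S \<omega>\<bar> + S \<omega>) / 2 \<le> \<eta> / 4 + (l / 2 * (S \<omega>)\<^sup>2 + 1 / (2 * l) * indicator A \<omega>)"
      using amgm \<eta> \<omega> by (cases "\<omega> \<in> A"; cases "S \<omega> \<ge> 0") (simp_all add: A_def)
  qed (use S indicator in \<open>auto intro!: Bochner_Integration.integrable_add\<close>)
  also have "\<dots> = \<eta> / 4 + (l / 2 * v + 1 / (2 * l) * prob A)"
    using S v indicator by (simp add: prob_space)
  finally have "expectation (\<lambda>\<omega>. \<bar>S \<omega>\<bar>) / 2 \<le> \<eta> / 4 + (l / 2 * v + 1 / (2 * l) * prob A)"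
    using S mean by simp
  then have "\<eta> / 4 \<le> l / 2 * v + 1 / (2 * l) * prob A" using \<eta> by simp
  moreover have "l / 2 * v = \<eta> / 8" "1 / (2 * l) = 2 * v / \<eta>" using v \<eta> by (simp_all add: l_def)
  ultimately have "\<eta> / 8 \<le> 2 * v / \<eta> * prob A" by simp
  then show ?thesis using v \<eta> by (simp add: A_def field_simps power2_eq_square)
qed

text \<open>The common law is a parameter because all the constants below depend on the family only through
  it, and so do not depend on the finite set of indices or on the weights.\<close>

locale centered_iid = prob_space M for M :: "'a measure" +
  fixes X :: "'i \<Rightarrow> 'a \<Rightarrow> real" and I :: "'i set" and D :: "real measure"
  assumes indep: "indep_vars (\<lambda>_. borel) X I"
    and distr: "i \<in> I \<Longrightarrow> distr M borel (X i) = D"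
    and real_distribution_D: "real_distribution D"
    and square_integrable_D: "integrable D (\<lambda>x. x\<^sup>2)"
    and mean_D: "(\<integral>x. x \<partial>D) = 0"
    and variance_D: "(\<integral>x. x\<^sup>2 \<partial>D) > 0"
begin

abbreviation v where "v \<equiv> \<integral>x. x\<^sup>2 \<partial>D"

interpretation D: real_distribution D by (rule real_distribution_D)

lemma rv: "i \<in> I \<Longrightarrow> X i \<in> borel_measurable M"
  using indep unfolding indep_vars_def2 by blast

lemma integrable_D: "integrable D (\<lambda>x. x)"
  by (rule D.square_integrable_imp_integrable) (use square_integrable_D in auto)

lemma moments:
  assumes i: "i \<in> I"
  shows "integrable M (X i)" "integrable M (\<lambda>\<omega>. (X i \<omega>)\<^sup>2)" "expectation (X i) = 0"
    "expectation (\<lambda>\<omega>. (X i \<omega>)\<^sup>2) = v"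
  using integrable_D square_integrable_D mean_D rv[OF i]
  by (simp_all add: distr[OF i, symmetric] integrable_distr_eq integral_distr)

text \<open>Mixed products of distinct centred independent variables have mean zero, so second moments
  add up.\<close>

lemma sum_moments:
  assumes "finite J" "J \<subseteq> I"
  shows "integrable M (\<lambda>\<omega>. (\<Sum>i\<in>J. a i * X i \<omega>)\<^sup>2) \<and>
    expectation (\<lambda>\<omega>. (\<Sum>i\<in>J. a i * X i \<omega>)\<^sup>2) = v * (\<Sum>i\<in>J. (a i)\<^sup>2)"
  using assms
proof (induction J)
  case empty
  then show ?case by simp
next
  case (insert j J)
  define S where "S = (\<lambda>\<omega>. \<Sum>i\<in>J. a i * X i \<omega>)"
  define Y where "Y = (\<lambda>\<omega>. a j * X j \<omega>)"
  have j: "j \<in> I" and J: "J \<subseteq> I" using insert.prems by auto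
  have "indep_vars (\<lambda>_. borel) (\<lambda>i \<omega>. a i * X i \<omega>) (insert j J)"
    by (rule indep_vars_compose2[OF indep_vars_subset[OF indep]]) (use insert.prems in auto)
  from indep_vars_sum[OF insert.hyps(1,2) this] have ind: "indep_var borel Y borel S"
    by (simp add: S_def Y_def)
  have Y: "integrable M Y" "expectation Y = 0" using moments[OF j] by (auto simp: Y_def)
  have S: "integrable M S" unfolding S_def using moments J by (intro Bochner_Integration.integrable_sum) auto
  have YS: "integrable M (\<lambda>\<omega>. Y \<omega> * S \<omega>)" "expectation (\<lambda>\<omega>. Y \<omega> * S \<omega>) = 0"
    using indep_var_integrable[OF ind Y(1) S] indep_var_lebesgue_integral[OF ind Y(1) S] Y(2) by auto
  have Y2: "integrable M (\<lambda>\<omega>. (Y \<omega>)\<^sup>2)" "expectation (\<lambda>\<omega>. (Y \<omega>)\<^sup>2) = v * (a j)\<^sup>2"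
    using moments[OF j] by (auto simp: Y_def power_mult_distrib)
  have S2: "integrable M (\<lambda>\<omega>. (S \<omega>)\<^sup>2)"
    "expectation (\<lambda>\<omega>. (S \<omega>)\<^sup>2) = v * (\<Sum>i\<in>J. (a i)\<^sup>2)"
    using insert.IH[OF J] by (auto simp: S_def)
  have eq: "(\<Sum>i\<in>insert j J. a i * X i \<omega>)\<^sup>2 = (Y \<omega>)\<^sup>2 + (S \<omega>)\<^sup>2 + 2 * (Y \<omega> * S \<omega>)" for \<omega>
    using insert.hyps by (simp add: power2_sum S_def Y_def)
  show ?case
    unfolding eq using S2 insert.hyps YS Y2
    by (simp add: distrib_left)
qed

lemma integrable_sum: "J \<subseteq> I \<Longrightarrow> integrable M (\<lambda>\<omega>. \<Sum>i\<in>J. a i * X i \<omega>)"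
  using moments by (intro Bochner_Integration.integrable_sum) auto

text \<open>To second order the characteristic function of \<open>D\<close> is \<open>1 - t\<^sup>2 v / 2\<close>. With only two moments
  available, the remainder is controlled by a truncated third moment, which tends to 0 with \<open>t\<close> by
  dominated convergence; near 0 it costs at most a third of the quadratic term.\<close>

lemma char_gaussian_bound:
  obtains s where "s > 0" "\<And>t. \<bar>t\<bar> \<le> s \<Longrightarrow> cmod (char D t) \<le> exp (- (t\<^sup>2 * v / 3))"
proof -
  have "(\<lambda>n. \<integral>x. min (6 * x\<^sup>2) (1 / real (Suc n) * \<bar>x\<bar> ^ 3) \<partial>D) \<longlonglongrightarrow> (\<integral>x. 0 \<partial>D)"
  proof (rule integral_dominated_convergence[where w = "\<lambda>x. 6 * x\<^sup>2"])
    show "AE x in D. (\<lambda>n. min (6 * x\<^sup>2) (1 / real (Suc n) * \<bar>x\<bar> ^ 3)) \<longlonglongrightarrow> 0"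
    proof (rule AE_I2)
      fix x :: real
      have "(\<lambda>n. min (6 * x\<^sup>2) (1 / real (Suc n) * \<bar>x\<bar> ^ 3)) \<longlonglongrightarrow> min (6 * x\<^sup>2) (0 * \<bar>x\<bar> ^ 3)"
        by (intro tendsto_intros LIMSEQ_Suc lim_1_over_n)
      then show "(\<lambda>n. min (6 * x\<^sup>2) (1 / real (Suc n) * \<bar>x\<bar> ^ 3)) \<longlonglongrightarrow> 0" by simp
    qed
  qed (use square_integrable_D in auto)
  then have "\<forall>\<^sub>F n in sequentially. (\<integral>x. min (6 * x\<^sup>2) (1 / real (Suc n) * \<bar>x\<bar> ^ 3) \<partial>D) < v"
    using variance_D by (intro order_tendstoD(2)) auto
  then obtain n where n: "(\<integral>x. min (6 * x\<^sup>2) (1 / real (Suc n) * \<bar>x\<bar> ^ 3) \<partial>D) < v"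
    by (auto simp: eventually_sequentially)
  define s where "s = min (1 / real (Suc n)) (sqrt (2 / v))"
  show ?thesis
  proof
    show "s > 0" using variance_D by (simp add: s_def)
    fix t :: real assume t: "\<bar>t\<bar> \<le> s"
    have "(\<integral>x. min (6 * x\<^sup>2) (\<bar>t\<bar> * \<bar>x\<bar> ^ 3) \<partial>D) \<le>
        (\<integral>x. min (6 * x\<^sup>2) (1 / real (Suc n) * \<bar>x\<bar> ^ 3) \<partial>D)"
    proof (rule integral_mono)
      have "integrable D (\<lambda>x. min (6 * x\<^sup>2) (r * \<bar>x\<bar> ^ 3))" if "r \<ge> 0" for r
        by (rule Bochner_Integration.integrable_bound[where f = "\<lambda>x. 6 * x\<^sup>2"])
          (use square_integrable_D that in auto)
      from this[of "\<bar>t\<bar>"] this[of "1 / real (Suc n)"]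
      show "integrable D (\<lambda>x. min (6 * x\<^sup>2) (\<bar>t\<bar> * \<bar>x\<bar> ^ 3))"
        "integrable D (\<lambda>x. min (6 * x\<^sup>2) (1 / real (Suc n) * \<bar>x\<bar> ^ 3))"
        by auto
      show "min (6 * x\<^sup>2) (\<bar>t\<bar> * \<bar>x\<bar> ^ 3) \<le> min (6 * x\<^sup>2) (1 / real (Suc n) * \<bar>x\<bar> ^ 3)" for x
        using t by (intro min.mono mult_right_mono) (auto simp: s_def)
    qed
    then have third: "(\<integral>x. min (6 * x\<^sup>2) (\<bar>t\<bar> * \<bar>x\<bar> ^ 3) \<partial>D) \<le> v" using n by linarith
    have "cmod (char D t - (1 - t\<^sup>2 * v / 2)) \<le>
        (t\<^sup>2 / 6) * (\<integral>x. min (6 * x\<^sup>2) (\<bar>t\<bar> * \<bar>x\<bar> ^ 3) \<partial>D)"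
      by (rule D.char_approx3) (use integrable_D mean_D square_integrable_D in auto)
    also have "\<dots> \<le> (t\<^sup>2 / 6) * v" using third by (intro mult_left_mono) auto
    finally have d: "cmod (char D t - (1 - t\<^sup>2 * v / 2)) \<le> t\<^sup>2 * v / 6" by simp
    have "\<bar>t\<bar> \<le> sqrt (2 / v)" using t by (simp add: s_def)
    then have "t\<^sup>2 \<le> 2 / v" using real_sqrt_ge_abs1 by (metis real_sqrt_abs real_sqrt_le_iff)
    then have tv: "t\<^sup>2 * v / 2 \<le> 1" using variance_D by (simp add: field_simps)
    have "cmod (char D t) \<le> cmod (char D t - (1 - t\<^sup>2 * v / 2)) + cmod (1 - t\<^sup>2 * v / 2)"
      using norm_triangle_ineq[of "char D t - (1 - t\<^sup>2 * v / 2)" "1 - t\<^sup>2 * v / 2"] by simp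
    also have "cmod (1 - t\<^sup>2 * v / 2) = 1 - t\<^sup>2 * v / 2"
    proof -
      have "1 - complex_of_real t ^ 2 * complex_of_real v / 2 = complex_of_real (1 - t\<^sup>2 * v / 2)" by simp
      then show ?thesis using tv by (simp only: norm_of_real)
    qed
    finally have "cmod (char D t) \<le> 1 + - (t\<^sup>2 * v / 3)" using d by simp
    also have "\<dots> \<le> exp (- (t\<^sup>2 * v / 3))" by (rule exp_ge_add_one_self)
    finally show "cmod (char D t) \<le> exp (- (t\<^sup>2 * v / 3))" .
  qed
qed

text \<open>The bound \<open>exp (- t\<^sup>2 v / 3)\<close> is stable under products: at a fixed small frequency the
  characteristic function of every normalized weighted sum \<open>S\<close> stays away from 1 by the same amount. As
  \<open>\<bar>exp (\<i> s S) - 1\<bar> \<le> s \<bar>S\<bar>\<close>, this is a uniform lower bound for the mean of \<open>\<bar>S\<bar>\<close>.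
  Normalized weights have modulus at most 1, so all factors stay in the range of the bound.\<close>

lemma abs_moment_of_normalized_sum:
  obtains \<eta> where "\<eta> > 0"
    "\<And>J a. finite J \<Longrightarrow> J \<subseteq> I \<Longrightarrow> (\<Sum>i\<in>J. (a i)\<^sup>2) = 1 \<Longrightarrow>
       \<eta> \<le> expectation (\<lambda>\<omega>. \<bar>\<Sum>i\<in>J. a i * X i \<omega>\<bar>)"
proof -
  obtain s where s: "s > 0" and bound: "\<And>t. \<bar>t\<bar> \<le> s \<Longrightarrow> cmod (char D t) \<le> exp (- (t\<^sup>2 * v / 3))"
    using char_gaussian_bound by blast
  show ?thesis
  proof
    show "(1 - exp (- (s\<^sup>2 * v / 3))) / s > 0" using s variance_D by simp
    fix J a assume J: "finite J" "J \<subseteq> I" and a: "(\<Sum>i\<in>J. (a i)\<^sup>2) = (1::real)"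
    define S where "S = (\<lambda>\<omega>. \<Sum>i\<in>J. a i * X i \<omega>)"
    have S: "integrable M S" unfolding S_def using integrable_sum[OF J(2)] .
    have [measurable]: "S \<in> borel_measurable M" using S by auto
    have char_i: "char (distr M borel (\<lambda>\<omega>. a i * X i \<omega>)) s = char D (a i * s)" if "i \<in> J" for i
      using that J rv[of i] by (auto simp: char_def integral_distr distr[symmetric] mult_ac)
    have "indep_vars (\<lambda>_. borel) (\<lambda>i \<omega>. a i * X i \<omega>) J"
      by (rule indep_vars_compose2[OF indep_vars_subset[OF indep]]) (use J in auto)
    from char_distr_sum[OF this, of s]
    have "cmod (char (distr M borel S) s) = (\<Prod>i\<in>J. cmod (char D (a i * s)))"
      using char_i by (simp add: prod_norm S_def)
    also have "\<dots> \<le> (\<Prod>i\<in>J. exp (- ((a i * s)\<^sup>2 * v / 3)))"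
    proof (intro prod_mono conjI bound)
      fix i assume i: "i \<in> J"
      have "(a i)\<^sup>2 \<le> (\<Sum>i\<in>J. (a i)\<^sup>2)" using i J by (intro member_le_sum) auto
      then have "\<bar>a i\<bar> \<le> 1" using a abs_square_le_1 by metis
      then show "\<bar>a i * s\<bar> \<le> s" using s by (simp add: abs_mult mult_left_le_one_le)
    qed simp
    also have "\<dots> = exp (\<Sum>i\<in>J. - ((a i * s)\<^sup>2 * v / 3))"
      using J by (simp add: exp_sum)
    also have "(\<Sum>i\<in>J. - ((a i * s)\<^sup>2 * v / 3)) = - (s\<^sup>2 * v / 3) * (\<Sum>i\<in>J. (a i)\<^sup>2)"
      by (simp add: sum_distrib_left sum_negf power_mult_distrib mult_ac)
    finally have small: "cmod (char (distr M borel S) s) \<le> exp (- (s\<^sup>2 * v / 3))" using a by simp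
    have iexp_int: "integrable M (\<lambda>\<omega>. iexp (s * S \<omega>))"
      by (rule integrable_const_bound[where B = 1]) auto
    have "1 - exp (- (s\<^sup>2 * v / 3)) \<le> cmod (char (distr M borel S) s - 1)"
      using norm_triangle_ineq2[of 1 "char (distr M borel S) s"] small by (simp add: norm_minus_commute)
    also have "char (distr M borel S) s - 1 = (CLINT \<omega>|M. iexp (s * S \<omega>) - 1)"
      using iexp_int by (simp add: char_def integral_distr prob_space)
    also have "cmod \<dots> \<le> (\<integral>\<omega>. cmod (iexp (s * S \<omega>) - 1) \<partial>M)"
      by (rule integral_norm_bound)
    also have "\<dots> \<le> (\<integral>\<omega>. s * \<bar>S \<omega>\<bar> \<partial>M)"
    proof (rule integral_mono)
      show "integrable M (\<lambda>\<omega>. cmod (iexp (s * S \<omega>) - 1))"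
        using iexp_int by (intro integrable_norm) auto
      show "integrable M (\<lambda>\<omega>. s * \<bar>S \<omega>\<bar>)" using S by auto
      show "cmod (iexp (s * S \<omega>) - 1) \<le> s * \<bar>S \<omega>\<bar>" for \<omega>
        using iexp_approx1[of "s * S \<omega>" 0] s by (simp add: abs_mult)
    qed
    also have "\<dots> = s * expectation (\<lambda>\<omega>. \<bar>S \<omega>\<bar>)" by simp
    finally show "(1 - exp (- (s\<^sup>2 * v / 3))) / s \<le> expectation (\<lambda>\<omega>. \<bar>\<Sum>i\<in>J. a i * X i \<omega>\<bar>)"
      using s unfolding S_def by (simp add: field_simps)
  qed
qed

lemma prob_large_sum:
  obtains c \<delta> where "c > 0" "\<delta> > 0"
    "\<And>J a. finite J \<Longrightarrow> J \<subseteq> I \<Longrightarrow> 0 < (\<Sum>i\<in>J. (a i)\<^sup>2) \<Longrightarrow>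
       \<delta> \<le> prob {\<omega> \<in> space M. c * sqrt (\<Sum>i\<in>J. (a i)\<^sup>2) \<le> (\<Sum>i\<in>J. a i * X i \<omega>)}"
proof -
  obtain \<eta> where \<eta>: "\<eta> > 0" and L1: "\<And>J a. finite J \<Longrightarrow> J \<subseteq> I \<Longrightarrow> (\<Sum>i\<in>J. (a i)\<^sup>2) = 1 \<Longrightarrow>
       \<eta> \<le> expectation (\<lambda>\<omega>. \<bar>\<Sum>i\<in>J. a i * X i \<omega>\<bar>)"
    using abs_moment_of_normalized_sum by blast
  show ?thesis
  proof
    show "\<eta> / 4 > 0" "\<eta>\<^sup>2 / (16 * v) > 0" using \<eta> variance_D by auto
    fix J a assume J: "finite J" "J \<subseteq> I" and pos: "0 < (\<Sum>i\<in>J. (a i :: real)\<^sup>2)"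
    define r where "r = sqrt (\<Sum>i\<in>J. (a i)\<^sup>2)"
    have r: "r > 0" "r\<^sup>2 = (\<Sum>i\<in>J. (a i)\<^sup>2)" using pos by (auto simp: r_def)
    have one: "(\<Sum>i\<in>J. (a i / r)\<^sup>2) = 1"
      using r pos by (simp add: power_divide sum_divide_distrib[symmetric])
    have sum: "(\<Sum>i\<in>J. a i / r * X i \<omega>) = (\<Sum>i\<in>J. a i * X i \<omega>) / r" for \<omega>
      by (simp add: sum_divide_distrib)
    have "\<eta>\<^sup>2 / (16 * v) \<le> prob {\<omega> \<in> space M. \<eta> / 4 \<le> (\<Sum>i\<in>J. a i / r * X i \<omega>)}"
    proof (rule prob_ge_of_abs_moment)
      show "expectation (\<lambda>\<omega>. \<Sum>i\<in>J. a i / r * X i \<omega>) = 0"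
        using moments J by (subst Bochner_Integration.integral_sum) (auto intro!: sum.neutral)
      show "expectation (\<lambda>\<omega>. (\<Sum>i\<in>J. a i / r * X i \<omega>)\<^sup>2) = v"
        using sum_moments[OF J, of "\<lambda>i. a i / r"] one by simp
    qed (use sum_moments[OF J, of "\<lambda>i. a i / r"] integrable_sum[OF J(2), of "\<lambda>i. a i / r"]
        variance_D \<eta> L1[OF J one] in auto)
    also have "{\<omega> \<in> space M. \<eta> / 4 \<le> (\<Sum>i\<in>J. a i / r * X i \<omega>)} =
        {\<omega> \<in> space M. \<eta> / 4 * r \<le> (\<Sum>i\<in>J. a i * X i \<omega>)}"
      unfolding sum using r by (simp add: field_simps)
    finally show "\<eta>\<^sup>2 / (16 * v) \<le>
        prob {\<omega> \<in> space M. \<eta> / 4 * sqrt (\<Sum>i\<in>J. (a i)\<^sup>2) \<le> (\<Sum>i\<in>J. a i * X i \<omega>)}"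
      by (simp add: r_def)
  qed
qed

text \<open>Let \<open>G m K\<close> be the event that the first \<open>m\<close> sums do not exceed \<open>K\<close>. It is determined by
  finitely many of the variables. In a sum with large variance these variables hardly matter, since
  their weights are bounded, and the rest of the sum is independent of \<open>G m K\<close> and exceeds any given level
  with probability at least \<open>\<delta>\<close>. Hence the probability \<open>p\<close> that no sum exceeds \<open>K\<close> satisfies
  \<open>p \<le> P (G m K) * (1 - \<delta>)\<close> up to an arbitrarily small error. Letting \<open>m\<close> tend to infinity gives
  \<open>p \<le> p * (1 - \<delta>)\<close>, so that \<open>p = 0\<close>.\<close>

lemma weighted_sums_unbounded:
  fixes a :: "nat \<Rightarrow> 'i \<Rightarrow> real"
  assumes B: "\<And>n. finite (B n)" "\<And>n. B n \<subseteq> I"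
    and a: "\<And>n i. i \<in> B n \<Longrightarrow> \<bar>a n i\<bar> \<le> 1"
    and large: "filterlim (\<lambda>n. \<Sum>i\<in>B n. (a n i)\<^sup>2) at_top sequentially"
  shows "AE \<omega> in M. \<forall>K. \<exists>n. K < (\<Sum>i\<in>B n. a n i * X i \<omega>)"
proof -
  define Y where "Y n \<omega> = (\<Sum>i\<in>B n. a n i * X i \<omega>)" for n \<omega>
  define G where "G m K = {\<omega> \<in> space M. \<forall>n\<le>m. Y n \<omega> \<le> K}" for m and K :: real
  have Y_rv [measurable]: "Y n \<in> borel_measurable M" for n
    unfolding Y_def using rv B by (intro borel_measurable_sum borel_measurable_times) auto
  have G_meas [measurable]: "G m K \<in> sets M" for m K unfolding G_def by measurable
  obtain c \<delta> where c: "c > 0" "\<delta> > 0" and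
    big: "\<And>J a. finite J \<Longrightarrow> J \<subseteq> I \<Longrightarrow> 0 < (\<Sum>i\<in>J. (a i)\<^sup>2) \<Longrightarrow>
       \<delta> \<le> prob {\<omega> \<in> space M. c * sqrt (\<Sum>i\<in>J. (a i)\<^sup>2) \<le> (\<Sum>i\<in>J. a i * X i \<omega>)}"
    using prob_large_sum by blast

  have step: "prob (\<Inter>n. G n K) \<le> prob (G m K) * (1 - \<delta>) + e" if e: "e > 0" for m K and e :: real
  proof -
    define A where "A = (\<Union>n\<le>m. B n)"
    have A: "finite A" "A \<subseteq> I" using B by (auto simp: A_def)
    \<comment> \<open>\<open>Q\<close> dominates the contribution of the variables that determine \<open>G m K\<close> to every sum.\<close>
    define Q where "Q \<omega> = (\<Sum>i\<in>A. \<bar>X i \<omega>\<bar>)" for \<omega>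
    have Q_int: "integrable M Q" unfolding Q_def using moments A
      by (intro Bochner_Integration.integrable_sum) auto
    then have [measurable]: "Q \<in> borel_measurable M" by auto
    define t where "t = (expectation Q + 1) / e"
    have "expectation Q \<ge> 0" by (rule integral_nonneg_AE) (auto simp: Q_def intro!: sum_nonneg)
    then have t: "t > 0" using e by (simp add: t_def)
    have "prob {\<omega> \<in> space M. t \<le> Q \<omega>} \<le> expectation Q / t"
      by (rule integral_Markov_inequality_measure[where A = "{}"])
        (use Q_int t in \<open>auto simp: Q_def[abs_def] intro!: AE_I2 sum_nonneg\<close>)
    also have "\<dots> \<le> e" using t e \<open>expectation Q \<ge> 0\<close> by (simp add: t_def field_simps)
    finally have Q_small: "prob {\<omega> \<in> space M. t \<le> Q \<omega>} \<le> e" .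

    \<comment> \<open>Losing the indices in \<open>A\<close> costs at most \<open>card A\<close> of the sum of squares, and a remaining sum of
      squares above \<open>r\<close> puts the threshold of \<open>big\<close> above \<open>K + t\<close>.\<close>
    define r where "r = (max 0 (K + t) / c + 1)\<^sup>2"
    have "\<forall>\<^sub>F n in sequentially. r + card A < (\<Sum>i\<in>B n. (a n i)\<^sup>2)"
      using large by (simp add: filterlim_at_top_dense)
    then obtain n where n: "r + card A < (\<Sum>i\<in>B n. (a n i)\<^sup>2)"
      by (auto simp: eventually_sequentially)
    define Z where "Z \<omega> = (\<Sum>i\<in>B n - A. a n i * X i \<omega>)" for \<omega>
    have BA: "finite (B n - A)" "B n - A \<subseteq> I" using B by auto
    have [measurable]: "Z \<in> borel_measurable M"
      unfolding Z_def using rv B by (intro borel_measurable_sum borel_measurable_times) auto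
    have split: "sum f (B n) = sum f (B n \<inter> A) + sum f (B n - A)" for f :: "'i \<Rightarrow> real"
      using B by (subst sum.Int_Diff) auto
    have "(\<Sum>i\<in>B n \<inter> A. (a n i)\<^sup>2) \<le> (\<Sum>i\<in>B n \<inter> A. 1)"
      using a by (intro sum_mono) (simp add: abs_square_le_1)
    also have "\<dots> \<le> card A" using A by (simp add: card_mono)
    finally have r: "r < (\<Sum>i\<in>B n - A. (a n i)\<^sup>2)" using n split[of "\<lambda>i. (a n i)\<^sup>2"] by simp
    have "max 0 (K + t) / c + 1 \<le> sqrt (\<Sum>i\<in>B n - A. (a n i)\<^sup>2)"
      using r by (intro real_le_rsqrt) (simp add: r_def)
    then have "K + t < c * sqrt (\<Sum>i\<in>B n - A. (a n i)\<^sup>2)"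
      using c by (simp add: field_simps)
    then have "prob {\<omega> \<in> space M. c * sqrt (\<Sum>i\<in>B n - A. (a n i)\<^sup>2) \<le> Z \<omega>}
        \<le> prob {\<omega> \<in> space M. \<not> Z \<omega> \<le> K + t}"
      by (intro finite_measure_mono) auto
    moreover have "0 \<le> r" by (simp add: r_def)
    ultimately have "\<delta> \<le> prob {\<omega> \<in> space M. \<not> Z \<omega> \<le> K + t}"
      using big[OF BA, of "a n"] r by (simp add: Z_def)
    also have "\<dots> = 1 - prob {\<omega> \<in> space M. Z \<omega> \<le> K + t}"
      by (rule prob_neg) measurable
    finally have Z_prob: "prob {\<omega> \<in> space M. Z \<omega> \<le> K + t} \<le> 1 - \<delta>" by simp

    \<comment> \<open>\<open>SA\<close> and \<open>SZ\<close> express the two events through disjoint blocks of coordinates.\<close>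
    define SA where "SA = {x \<in> space (PiM A (\<lambda>_. borel :: real measure)).
      \<forall>k\<in>{..m}. (\<Sum>i\<in>B k. a k i * x i) \<le> K}"
    define SZ where "SZ = {x \<in> space (PiM (B n - A) (\<lambda>_. borel :: real measure)).
      (\<Sum>i\<in>B n - A. a n i * x i) \<le> K + t}"
    have "(\<lambda>x. \<Sum>i\<in>B k. a k i * x i) \<in> borel_measurable (PiM A (\<lambda>_. borel :: real measure))" if "k \<le> m" for k
      using that by (intro borel_measurable_sum borel_measurable_times borel_measurable_const
          measurable_component_singleton) (auto simp: A_def)
    then have SA: "SA \<in> sets (PiM A (\<lambda>_. borel))"
      unfolding SA_def by (intro sets.sets_Collect_finite_All borel_measurable_le) auto
    have SZ: "SZ \<in> sets (PiM (B n - A) (\<lambda>_. borel))" unfolding SZ_def by measurable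
    have SA_eq: "(\<lambda>\<omega>. restrict (\<lambda>i. X i \<omega>) A) -` SA \<inter> space M = G m K"
    proof -
      have "(\<Sum>i\<in>B k. a k i * restrict (\<lambda>i. X i \<omega>) A i) = Y k \<omega>" if "k \<le> m" for k \<omega>
        unfolding Y_def using that by (intro sum.cong) (auto simp: A_def)
      then show ?thesis by (auto simp: SA_def G_def space_PiM)
    qed
    have SZ_eq: "(\<lambda>\<omega>. restrict (\<lambda>i. X i \<omega>) (B n - A)) -` SZ \<inter> space M = {\<omega> \<in> space M. Z \<omega> \<le> K + t}"
      by (auto simp: SZ_def Z_def space_PiM)
    have "G m K \<inter> {\<omega> \<in> space M. Z \<omega> \<le> K + t} =
        (\<lambda>\<omega>. (restrict (\<lambda>i. X i \<omega>) A, restrict (\<lambda>i. X i \<omega>) (B n - A))) -` (SA \<times> SZ) \<inter> space M"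
      using SA_eq SZ_eq by blast
    then have ind: "prob (G m K \<inter> {\<omega> \<in> space M. Z \<omega> \<le> K + t}) =
        prob (G m K) * prob {\<omega> \<in> space M. Z \<omega> \<le> K + t}"
      using indep_varD[OF indep_var_restrict[OF indep _ A(2) BA(2)] SA SZ] SA_eq SZ_eq by auto

    have "(\<Inter>n. G n K) \<subseteq> (G m K \<inter> {\<omega> \<in> space M. Z \<omega> \<le> K + t}) \<union> {\<omega> \<in> space M. t \<le> Q \<omega>}"
    proof
      fix \<omega> assume \<omega>: "\<omega> \<in> (\<Inter>n. G n K)"
      then have Yn: "Y n \<omega> \<le> K" "\<omega> \<in> space M" "\<omega> \<in> G m K" by (auto simp: G_def)
      have "- Q \<omega> \<le> (\<Sum>i\<in>B n \<inter> A. - \<bar>X i \<omega>\<bar>)"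
        unfolding Q_def sum_negf using A by (simp add: sum_mono2)
      also have "\<dots> \<le> (\<Sum>i\<in>B n \<inter> A. a n i * X i \<omega>)"
      proof (rule sum_mono)
        fix i assume "i \<in> B n \<inter> A"
        then have "\<bar>a n i * X i \<omega>\<bar> \<le> \<bar>X i \<omega>\<bar>" using a by (simp add: abs_mult mult_left_le_one_le)
        then show "- \<bar>X i \<omega>\<bar> \<le> a n i * X i \<omega>" by linarith
      qed
      finally have "Z \<omega> \<le> K + Q \<omega>"
        using Yn(1) split[of "\<lambda>i. a n i * X i \<omega>"] by (simp add: Y_def Z_def)
      then show "\<omega> \<in> (G m K \<inter> {\<omega> \<in> space M. Z \<omega> \<le> K + t}) \<union> {\<omega> \<in> space M. t \<le> Q \<omega>}"
        using Yn by auto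
    qed
    then have "prob (\<Inter>n. G n K) \<le>
        prob ((G m K \<inter> {\<omega> \<in> space M. Z \<omega> \<le> K + t}) \<union> {\<omega> \<in> space M. t \<le> Q \<omega>})"
      by (intro finite_measure_mono) measurable
    also have "\<dots> \<le> prob (G m K \<inter> {\<omega> \<in> space M. Z \<omega> \<le> K + t}) + prob {\<omega> \<in> space M. t \<le> Q \<omega>}"
      by (intro measure_Un_le) measurable
    also have "\<dots> \<le> prob (G m K) * (1 - \<delta>) + e"
      unfolding ind using Z_prob Q_small by (intro add_mono mult_left_mono) auto
    finally show ?thesis .
  qed

  have null: "(\<Inter>n. G n K) \<in> null_sets M" for K
  proof -
    let ?p = "prob (\<Inter>n. G n K)"
    have "(\<lambda>m. prob (G m K)) \<longlonglongrightarrow> ?p"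
      by (rule finite_Lim_measure_decseq) (auto simp: decseq_def G_def)
    then have lim: "(\<lambda>m. prob (G m K) * (1 - \<delta>)) \<longlonglongrightarrow> ?p * (1 - \<delta>)"
      by (intro tendsto_intros)
    have "?p \<le> ?p * (1 - \<delta>)"
    proof (rule field_le_epsilon)
      fix e :: real assume e: "e > 0"
      have "?p - e \<le> ?p * (1 - \<delta>)"
        by (rule LIMSEQ_le_const[OF lim]) (use step[OF e, of K] in \<open>auto simp: algebra_simps\<close>)
      then show "?p \<le> ?p * (1 - \<delta>) + e" by simp
    qed
    then have "\<delta> * ?p \<le> 0" by (simp add: algebra_simps)
    then have "?p = 0" using c measure_nonneg[of M "\<Inter>n. G n K"] by (simp add: mult_le_0_iff)
    then show ?thesis by (simp add: null_sets_def emeasure_eq_measure) measurable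
  qed
  have "AE \<omega> in M. \<forall>k::nat. \<omega> \<notin> (\<Inter>n. G n (real k))"
    unfolding AE_all_countable by (intro allI AE_not_in null)
  then show ?thesis
  proof (rule AE_mp, intro AE_I2 impI allI)
    fix \<omega> K assume \<omega>: "\<omega> \<in> space M" and not: "\<forall>k::nat. \<omega> \<notin> (\<Inter>n. G n (real k))"
    obtain k :: nat where k: "K \<le> real k" using real_arch_simple by blast
    from not obtain m where "\<omega> \<notin> G m (real k)" by blast
    with \<omega> obtain n where "real k < Y n \<omega>" by (auto simp: G_def not_le)
    with k show "\<exists>n. K < (\<Sum>i\<in>B n. a n i * X i \<omega>)" by (auto simp: Y_def intro!: exI[of _ n])
  qed
qed

end


section \<open>The limiting odometer\<close>

text \<open>This says \<open>\<Delta>u \<ge> f\<close>. For nonnegative \<open>u\<close> it suffices to bound the sums over finite sets of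
  neighbours, so the neighbourhoods need not be determined: it is enough to exhibit four
  neighbours wherever the inequality is applied.\<close>

definition superharmonic_above :: "(point \<Rightarrow> real) \<Rightarrow> (point \<Rightarrow> real) \<Rightarrow> bool" where
  "superharmonic_above f u \<longleftrightarrow>
     (\<forall>x\<in>SG_verts. \<forall>F. finite F \<longrightarrow> F \<subseteq> nbrs x \<longrightarrow> f x + (\<Sum>y\<in>F. u y) / 4 \<le> u x)"

text \<open>Right after a toppling of \<open>x\<close> at most mass 1 is left there, so by then \<open>x\<close> has emitted all mass
  above 1 that it had at the start or received from its neighbours. Since \<open>x\<close> is considered
  infinitely often, this applies after every time \<open>k\<close>.\<close>

lemma emitted_superharmonic:
  assumes s: "toppling_order n s" and x: "x \<in> SG_verts_upto n" and F: "finite F" "F \<subseteq> nbrs x"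
    and fin: "odometer \<sigma> n x < \<infinity>"
  shows "\<sigma> x - 1 + (\<Sum>y\<in>F. emitted s \<sigma> k y) / 4 \<le> enn2real (odometer \<sigma> n x)"
proof -
  obtain j where j: "j \<ge> k" "s j = x"
    using s x unfolding toppling_order_def INFM_nat_le by blast
  have "(\<Sum>y\<in>F. emitted s \<sigma> k y) \<le> (\<Sum>y\<in>F. emitted s \<sigma> j y)"
    by (intro sum_mono emitted_mono j)
  then have "\<sigma> x - 1 + (\<Sum>y\<in>F. emitted s \<sigma> k y) / 4 \<le> emitted s \<sigma> (Suc j) x"
    using config_ge[OF F, of \<sigma> s j] j by (simp add: emitted_Suc)
  also have "ennreal (emitted s \<sigma> (Suc j) x) \<le> odometer \<sigma> n x"
    unfolding odometer_eq_SUP[OF s] by (rule SUP_upper) simp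
  then have "emitted s \<sigma> (Suc j) x \<le> enn2real (odometer \<sigma> n x)"
    using fin enn2real_mono[of "ennreal (emitted s \<sigma> (Suc j) x)"] by (simp add: emitted_nonneg)
  finally show ?thesis .
qed

lemma stabilizes_imp_superharmonic:
  assumes "stabilizes \<sigma>"
  obtains u where "\<And>x. 0 \<le> u x" "superharmonic_above (\<lambda>x. \<sigma> x - 1) u"
proof
  let ?U = "odometer_infinity \<sigma>"
  have fin: "?U x < \<infinity>" for x
  proof (cases "x \<in> SG_verts")
    case True
    then show ?thesis using assms by (simp add: stabilizes_def)
  next
    case False
    then have "(\<lambda>n. odometer \<sigma> n x) = (\<lambda>n. 0)"
      by (intro ext odometer_outside) (auto simp: SG_verts_def)
    then have "?U x = 0"
      using odometer_tendsto_infinity[of \<sigma> x] by (simp add: LIMSEQ_const_iff)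
    then show ?thesis by simp
  qed
  have le: "odometer \<sigma> n x \<le> ?U x" for n x
    by (rule incseq_le[OF _ odometer_tendsto_infinity]) (auto simp: incseq_def odometer_mono)
  have fin_n: "odometer \<sigma> n x < \<infinity>" for n x
    using le fin by (rule le_less_trans)
  have lim_enn2real: "(\<lambda>n. enn2real (g n)) \<longlonglongrightarrow> enn2real c"
    if "g \<longlonglongrightarrow> c" "c < \<infinity>" for g :: "nat \<Rightarrow> ennreal" and c
    using that by (intro tendsto_enn2real) auto
  show "0 \<le> enn2real (?U x)" for x by simp
  show "superharmonic_above (\<lambda>x. \<sigma> x - 1) (\<lambda>x. enn2real (?U x))"
    unfolding superharmonic_above_def
  proof (intro ballI allI impI)
    fix x F assume x: "x \<in> SG_verts" and F: "finite F" "F \<subseteq> nbrs x"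
    obtain N where N: "x \<in> SG_verts_upto N" using x by (auto simp: SG_verts_def)
    have "\<sigma> x - 1 + (\<Sum>y\<in>F. enn2real (odometer \<sigma> n y)) / 4 \<le> enn2real (?U x)" if "n \<ge> N" for n
    proof -
      have xn: "x \<in> SG_verts_upto n" using N SG_verts_upto_mono[OF that] by auto
      obtain s where s: "toppling_order n s" using toppling_order_exists by blast
      have lim: "(\<lambda>k. emitted s \<sigma> k y) \<longlonglongrightarrow> enn2real (odometer \<sigma> n y)" for y
        using lim_enn2real[OF emitted_tendsto_odometer[OF s] fin_n] by (simp add: emitted_nonneg)
      have "\<sigma> x - 1 + (\<Sum>y\<in>F. enn2real (odometer \<sigma> n y)) / 4 \<le> enn2real (odometer \<sigma> n x)"
        by (rule LIMSEQ_le_const2[where X = "\<lambda>k. \<sigma> x - 1 + (\<Sum>y\<in>F. emitted s \<sigma> k y) / 4"])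
          (use emitted_superharmonic[OF s xn F fin_n] in \<open>auto intro!: tendsto_intros lim\<close>)
      also have "\<dots> \<le> enn2real (?U x)" using le fin by (intro enn2real_mono) auto
      finally show ?thesis .
    qed
    moreover have "(\<lambda>n. enn2real (odometer \<sigma> n y)) \<longlonglongrightarrow> enn2real (?U y)" for y
      by (rule lim_enn2real[OF odometer_tendsto_infinity fin])
    ultimately show "\<sigma> x - 1 + (\<Sum>y\<in>F. enn2real (?U y)) / 4 \<le> enn2real (?U x)"
      by (intro LIMSEQ_le_const2[where X = "\<lambda>n. \<sigma> x - 1 + (\<Sum>y\<in>F. enn2real (odometer \<sigma> n y)) / 4"]
          tendsto_add tendsto_divide tendsto_sum tendsto_const) auto
  qed
qed


section \<open>Lattice coordinates on the gasket\<close>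

text \<open>In these oblique integer coordinates the two translations that build the gasket are by
  \<open>(2^n, 0)\<close> and \<open>(0, 2^n)\<close>, so that positions are compared by integer arithmetic.\<close>

definition lattice_point :: "int \<Rightarrow> int \<Rightarrow> point" where
  "lattice_point i j = (of_int i + of_int j / 2, of_int j / 2 * sqrt 3)"

lemma lattice_point_eq_iff: "lattice_point i j = lattice_point i' j' \<longleftrightarrow> i = i' \<and> j = j'"
  by (auto simp: lattice_point_def)

lemma lattice_point_add: "lattice_point i j + lattice_point i' j' = lattice_point (i + i') (j + j')"
  by (simp add: lattice_point_def field_simps)

text \<open>Translated copies are considered because every copy splits into three copies of the previous
  level. All inductions on the level below rest on this form of self-similarity.\<close>

definition gasket_at :: "nat \<Rightarrow> int \<Rightarrow> int \<Rightarrow> bool" where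
  "gasket_at n i j \<longleftrightarrow> (+) (lattice_point i j) ` V n \<subseteq> SG_verts \<and>
     (\<forall>e\<in>E n. (+) (lattice_point i j) ` e \<in> SG_edges)"

lemma gasket_at_origin: "gasket_at n 0 0"
proof -
  have "(+) (lattice_point 0 0) = id" by (auto simp: lattice_point_def zero_prod_def[symmetric])
  then show ?thesis
    by (auto simp: gasket_at_def SG_verts_def SG_edges_def SG_verts_upto_def SG_edges_upto_def)
qed

lemma gasket_at_SucD:
  assumes "gasket_at (Suc n) i j"
  shows "gasket_at n i j" "gasket_at n (i + 2^n) j" "gasket_at n i (j + 2^n)"
proof -
  have shift: "(+) (lattice_point i j) \<circ> (+) (2^n, 0) = (+) (lattice_point (i + 2^n) j)"
    "(+) (lattice_point i j) \<circ> (+) (2^n / 2, 2^n / 2 * sqrt 3) = (+) (lattice_point i (j + 2^n))"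
    by (auto simp: fun_eq_iff lattice_point_def field_simps)
  show "gasket_at n i j" "gasket_at n (i + 2^n) j" "gasket_at n i (j + 2^n)"
    using assms unfolding gasket_at_def shift[symmetric]
    by (simp_all add: image_Un ball_Un image_comp)
qed

text \<open>Each corner of a triangle of level \<open>n\<close> has two neighbours inside it. These are all the edges
  that are needed: an inner vertex is the common corner of two smaller triangles, which supply its
  four neighbours.\<close>

lemma gasket_corners:
  assumes "gasket_at n i j"
  shows "lattice_point i j \<in> SG_verts \<and>
    {lattice_point i j, lattice_point (i + 1) j} \<in> SG_edges \<and>
    {lattice_point i j, lattice_point i (j + 1)} \<in> SG_edges"
   and "lattice_point (i + 2^n) j \<in> SG_verts \<and>
    {lattice_point (i + 2^n) j, lattice_point (i + 2^n - 1) j} \<in> SG_edges \<and>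
    {lattice_point (i + 2^n) j, lattice_point (i + 2^n - 1) (j + 1)} \<in> SG_edges"
   and "lattice_point i (j + 2^n) \<in> SG_verts \<and>
    {lattice_point i (j + 2^n), lattice_point i (j + 2^n - 1)} \<in> SG_edges \<and>
    {lattice_point i (j + 2^n), lattice_point (i + 1) (j + 2^n - 1)} \<in> SG_edges"
  using assms
proof (induction n arbitrary: i j)
  case 0
  have V0: "V 0 = {lattice_point 0 0, lattice_point 1 0, lattice_point 0 1}"
    by (simp add: lattice_point_def)
  have vert: "lattice_point (i + k) (j + l) \<in> SG_verts" if G: "gasket_at 0 i j" and kl: "lattice_point k l \<in> V 0"
    for i j k l
  proof -
    have "lattice_point i j + lattice_point k l \<in> SG_verts"
      using G kl unfolding gasket_at_def by blast
    then show ?thesis by (simp add: lattice_point_add)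
  qed
  have edge: "{lattice_point (i + k) (j + l), lattice_point (i + k') (j + l')} \<in> SG_edges"
    if G: "gasket_at 0 i j" and kl: "lattice_point k l \<in> V 0" "lattice_point k' l' \<in> V 0" "(k, l) \<noteq> (k', l')"
    for i j k l k' l'
  proof -
    have "{lattice_point k l, lattice_point k' l'} \<in> E 0"
    proof -
      have "lattice_point k l \<noteq> lattice_point k' l'" using kl by (auto simp: lattice_point_eq_iff)
      then show ?thesis unfolding E.simps using kl by blast
    qed
    then have "(+) (lattice_point i j) ` {lattice_point k l, lattice_point k' l'} \<in> SG_edges"
      using G unfolding gasket_at_def by blast
    then show ?thesis by (simp add: lattice_point_add)
  qed
  note vert = vert[unfolded V0] and edge = edge[unfolded V0]
  { case 1 show ?case using vert[OF 1, of 0 0] edge[OF 1, of 0 0 1 0] edge[OF 1, of 0 0 0 1] by simp }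
  { case 2 show ?case using vert[OF 2, of 1 0] edge[OF 2, of 1 0 0 0] edge[OF 2, of 1 0 0 1] by simp }
  { case 3 show ?case using vert[OF 3, of 0 1] edge[OF 3, of 0 1 0 0] edge[OF 3, of 0 1 1 0] by simp }
next
  case (Suc n)
  { case 1 then show ?case using Suc.IH(1) gasket_at_SucD by blast }
  { case 2 then show ?case
      using Suc.IH(2)[of "i + 2^n" j] gasket_at_SucD by (simp add: add.assoc) }
  { case 3 then show ?case
      using Suc.IH(3)[of i "j + 2^n"] gasket_at_SucD by (simp add: add.assoc) }
qed


section \<open>Harmonic functions on triangles\<close>

text \<open>The corners of the triangle are left out, since half of their neighbours lie outside. The three
  points added at each level are the midpoints of the sides, at which two smaller triangles meet.\<close>

fun interior_vertices :: "nat \<Rightarrow> int \<Rightarrow> int \<Rightarrow> (int \<times> int) set" where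
  "interior_vertices 0 i j = {}"
| "interior_vertices (Suc n) i j =
     interior_vertices n i j \<union> interior_vertices n (i + 2^n) j \<union> interior_vertices n i (j + 2^n) \<union>
     {(i + 2^n, j), (i, j + 2^n), (i + 2^n, j + 2^n)}"

text \<open>The function on the interior vertices that is harmonic with value \<open>a\<close> at the lower left,
  \<open>b\<close> at the lower right and \<open>c\<close> at the upper corner, extended by 0. On the gasket the value at the
  midpoint of a side is two fifths of each end point plus one fifth of the opposite corner; the three
  smaller triangles are filled in recursively. At most one of the six summands is nonzero at any point.\<close>

fun harmonic_extension :: "nat \<Rightarrow> int \<Rightarrow> int \<Rightarrow> real \<Rightarrow> real \<Rightarrow> real \<Rightarrow> int \<times> int \<Rightarrow> real" where
  "harmonic_extension 0 i j a b c x = 0"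
| "harmonic_extension (Suc n) i j a b c x =
     (let ab = (2*a + 2*b + c) / 5; ac = (2*a + b + 2*c) / 5; bc = (a + 2*b + 2*c) / 5 in
       harmonic_extension n i j a ab ac x + harmonic_extension n (i + 2^n) j ab b bc x +
       harmonic_extension n i (j + 2^n) ac bc c x +
       (if x = (i + 2^n, j) then ab else 0) + (if x = (i, j + 2^n) then ac else 0) +
       (if x = (i + 2^n, j + 2^n) then bc else 0))"

lemma finite_interior_vertices: "finite (interior_vertices n i j)"
  by (induction n arbitrary: i j) auto

lemma interior_vertices_in_SG_verts:
  "gasket_at n i j \<Longrightarrow> x \<in> interior_vertices n i j \<Longrightarrow> case_prod lattice_point x \<in> SG_verts"
proof (induction n arbitrary: i j)
  case (Suc n)
  note G = gasket_at_SucD[OF Suc.prems(1)]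
  show ?case
    using Suc.prems(2) Suc.IH[OF G(1)] Suc.IH[OF G(2)] Suc.IH[OF G(3)]
      gasket_corners(1)[OF G(2)] gasket_corners(1)[OF G(3)] gasket_corners(2)[OF G(3)] by auto
qed simp

text \<open>The last three conjuncts exclude the corners, the only points that two triangles of
  the same level can share. Hence the interiors of the three smaller triangles are disjoint.\<close>

lemma interior_vertices_bounds:
  "(k, l) \<in> interior_vertices n i j \<Longrightarrow> i \<le> k \<and> j \<le> l \<and> k + l \<le> i + j + 2^n \<and>
     (k, l) \<noteq> (i, j) \<and> (k, l) \<noteq> (i + 2^n, j) \<and> (k, l) \<noteq> (i, j + 2^n)"
proof (induction n arbitrary: i j)
  case (Suc n)
  define N :: int where "N = 2^n"
  then have p: "0 < N" by simp
  have pow: "2 ^ n = N" "2 ^ Suc n = N + N" by (simp_all add: N_def)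
  from Suc.prems consider "(k, l) \<in> interior_vertices n i j" | "(k, l) \<in> interior_vertices n (i + 2^n) j"
    | "(k, l) \<in> interior_vertices n i (j + 2^n)"
    | "(k, l) \<in> {(i + 2^n, j), (i, j + 2^n), (i + 2^n, j + 2^n)}" by auto
  then show ?case
  proof cases
    case 1 with Suc.IH[OF 1] p show ?thesis unfolding pow by auto
  next
    case 2 with Suc.IH[OF 2] p show ?thesis unfolding pow by auto
  next
    case 3 with Suc.IH[OF 3] p show ?thesis unfolding pow by auto
  next
    case 4 with p show ?thesis unfolding pow by auto
  qed
qed simp

lemma harmonic_extension_outside: "x \<notin> interior_vertices n i j \<Longrightarrow> harmonic_extension n i j a b c x = 0"
  by (induction n arbitrary: i j a b c) (auto simp: Let_def)

lemma harmonic_extension_nonneg: "0 \<le> a \<Longrightarrow> 0 \<le> b \<Longrightarrow> 0 \<le> c \<Longrightarrow> 0 \<le> harmonic_extension n i j a b c x"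
  by (induction n arbitrary: i j a b c) (auto simp: Let_def intro!: add_nonneg_nonneg)

lemma harmonic_extension_le_1:
  assumes "0 \<le> a" "0 \<le> b" "0 \<le> c" "a \<le> 1" "b \<le> 1" "c \<le> 1"
  shows "harmonic_extension n i j a b c x \<le> 1"
  using assms
proof (induction n arbitrary: i j a b c)
  case (Suc n)
  obtain k l where x: "x = (k, l)" by fastforce
  define ab ac bc where mid: "ab = (2*a + 2*b + c) / 5" "ac = (2*a + b + 2*c) / 5"
    "bc = (a + 2*b + 2*c) / 5"
  have mid01: "0 \<le> ab" "ab \<le> 1" "0 \<le> ac" "ac \<le> 1" "0 \<le> bc" "bc \<le> 1"
    using Suc.prems by (auto simp: mid)
  have IH: "harmonic_extension n i j a ab ac x \<le> 1" "harmonic_extension n (i + 2^n) j ab b bc x \<le> 1"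
    "harmonic_extension n i (j + 2^n) ac bc c x \<le> 1"
    using Suc.IH Suc.prems mid01 by auto
  define N :: int where "N = 2^n"
  then have p: "0 < N" by simp
  have pow: "2 ^ n = N" by (simp add: N_def)
  note bounds = interior_vertices_bounds[of k l n i j] interior_vertices_bounds[of k l n "i + 2^n" j]
    interior_vertices_bounds[of k l n i "j + 2^n"]
  have eq: "harmonic_extension (Suc n) i j a b c x = harmonic_extension n i j a ab ac x + harmonic_extension n (i + 2^n) j ab b bc x +
      harmonic_extension n i (j + 2^n) ac bc c x + (if x = (i + 2^n, j) then ab else 0) +
      (if x = (i, j + 2^n) then ac else 0) + (if x = (i + 2^n, j + 2^n) then bc else 0)"
    by (simp add: mid Let_def)
  consider "x \<in> interior_vertices n i j" "x \<notin> interior_vertices n (i + 2^n) j" "x \<notin> interior_vertices n i (j + 2^n)"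
      "x \<noteq> (i + 2^n, j)" "x \<noteq> (i, j + 2^n)" "x \<noteq> (i + 2^n, j + 2^n)"
    | "x \<notin> interior_vertices n i j" "x \<in> interior_vertices n (i + 2^n) j" "x \<notin> interior_vertices n i (j + 2^n)"
      "x \<noteq> (i + 2^n, j)" "x \<noteq> (i, j + 2^n)" "x \<noteq> (i + 2^n, j + 2^n)"
    | "x \<notin> interior_vertices n i j" "x \<notin> interior_vertices n (i + 2^n) j" "x \<in> interior_vertices n i (j + 2^n)"
      "x \<noteq> (i + 2^n, j)" "x \<noteq> (i, j + 2^n)" "x \<noteq> (i + 2^n, j + 2^n)"
    | "x \<notin> interior_vertices n i j" "x \<notin> interior_vertices n (i + 2^n) j" "x \<notin> interior_vertices n i (j + 2^n)"
  proof -
    have "\<not> (x \<in> interior_vertices n i j \<and> x \<in> interior_vertices n (i + 2^n) j)"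
      "\<not> (x \<in> interior_vertices n i j \<and> x \<in> interior_vertices n i (j + 2^n))"
      "\<not> (x \<in> interior_vertices n (i + 2^n) j \<and> x \<in> interior_vertices n i (j + 2^n))"
      using bounds p unfolding pow by (auto simp: x)
    moreover have "x \<notin> interior_vertices n i j \<and> x \<notin> interior_vertices n (i + 2^n) j \<and> x \<notin> interior_vertices n i (j + 2^n)"
      if "x \<in> {(i + 2^n, j), (i, j + 2^n), (i + 2^n, j + 2^n)}"
      using bounds p that unfolding pow by (auto simp: x)
    ultimately show thesis using that by blast
  qed
  then show ?case
  proof cases
    case 4 then show ?thesis unfolding eq using mid01 p by (simp add: pow harmonic_extension_outside)
  qed (unfold eq, use IH in \<open>simp_all add: harmonic_extension_outside\<close>)
qed simp

lemma sum_harmonic_extension_Suc: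
  fixes a b c
  defines "ab \<equiv> (2*a + 2*b + c) / 5" and "ac \<equiv> (2*a + b + 2*c) / 5"
    and "bc \<equiv> (a + 2*b + 2*c) / 5"
  shows "(\<Sum>x\<in>interior_vertices (Suc n) i j. harmonic_extension (Suc n) i j a b c x * g x) =
    (\<Sum>x\<in>interior_vertices n i j. harmonic_extension n i j a ab ac x * g x) +
    (\<Sum>x\<in>interior_vertices n (i + 2^n) j. harmonic_extension n (i + 2^n) j ab b bc x * g x) +
    (\<Sum>x\<in>interior_vertices n i (j + 2^n). harmonic_extension n i (j + 2^n) ac bc c x * g x) +
    ab * g (i + 2^n, j) + ac * g (i, j + 2^n) + bc * g (i + 2^n, j + 2^n)"
proof -
  let ?B = "interior_vertices (Suc n) i j"
  have fin: "finite ?B" by (rule finite_interior_vertices)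
  have ext: "(\<Sum>x\<in>?B. harmonic_extension n i' j' a' b' c' x * g x) =
      (\<Sum>x\<in>interior_vertices n i' j'. harmonic_extension n i' j' a' b' c' x * g x)"
    if "interior_vertices n i' j' \<subseteq> ?B" for i' j' a' b' c'
    by (rule sum.mono_neutral_right[OF fin that]) (auto simp: harmonic_extension_outside)
  have pt: "(\<Sum>x\<in>?B. (if x = y then r else 0) * g x) = r * g y" if "y \<in> ?B" for y and r :: real
    using that fin by (simp add: if_distrib[of "\<lambda>z. z * _"] cong: if_cong)
  have "(\<Sum>x\<in>?B. harmonic_extension (Suc n) i j a b c x * g x) =
    (\<Sum>x\<in>?B. harmonic_extension n i j a ab ac x * g x) +
    (\<Sum>x\<in>?B. harmonic_extension n (i + 2^n) j ab b bc x * g x) +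
    (\<Sum>x\<in>?B. harmonic_extension n i (j + 2^n) ac bc c x * g x) +
    (\<Sum>x\<in>?B. (if x = (i + 2^n, j) then ab else 0) * g x) +
    (\<Sum>x\<in>?B. (if x = (i, j + 2^n) then ac else 0) * g x) +
    (\<Sum>x\<in>?B. (if x = (i + 2^n, j + 2^n) then bc else 0) * g x)"
    unfolding sum.distrib[symmetric]
    by (intro sum.cong refl)
      (simp only: harmonic_extension.simps Let_def ab_def ac_def bc_def distrib_right)
  also have "\<dots> = (\<Sum>x\<in>interior_vertices n i j. harmonic_extension n i j a ab ac x * g x) +
    (\<Sum>x\<in>interior_vertices n (i + 2^n) j. harmonic_extension n (i + 2^n) j ab b bc x * g x) +
    (\<Sum>x\<in>interior_vertices n i (j + 2^n). harmonic_extension n i (j + 2^n) ac bc c x * g x) +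
    ab * g (i + 2^n, j) + ac * g (i, j + 2^n) + bc * g (i + 2^n, j + 2^n)"
    by (intro arg_cong2[where f = "(+)"] ext pt) auto
  finally show ?thesis .
qed

text \<open>By the minimum principle every value is at least \<open>m\<close>, and each level adds vertices; one
  midpoint per level already gives the bound.\<close>

lemma sum_harmonic_extension_square_ge:
  assumes "0 \<le> m" "m \<le> a" "m \<le> b" "m \<le> c"
  shows "real n * m\<^sup>2 \<le> (\<Sum>x\<in>interior_vertices n i j. (harmonic_extension n i j a b c x)\<^sup>2)"
  using assms
proof (induction n arbitrary: i j a b c)
  case (Suc n)
  define ab ac bc where mid: "ab = (2*a + 2*b + c) / 5" "ac = (2*a + b + 2*c) / 5"
    "bc = (a + 2*b + 2*c) / 5"
  have m: "m \<le> ab" "m \<le> ac" "m \<le> bc" using Suc.prems by (auto simp: mid)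
  let ?h = "harmonic_extension n i j a ab ac" and ?p = "\<lambda>x. if x = (i + 2^n, j) then ab else 0"
  let ?B = "interior_vertices (Suc n) i j"
  have "real n * m\<^sup>2 + m\<^sup>2 \<le> (\<Sum>x\<in>interior_vertices n i j. (?h x)\<^sup>2) + ab\<^sup>2"
    using Suc.IH[of a ab ac i j] Suc.prems m by (intro add_mono power_mono) auto
  also have "(\<Sum>x\<in>interior_vertices n i j. (?h x)\<^sup>2) = (\<Sum>x\<in>?B. (?h x)\<^sup>2)"
    by (rule sum.mono_neutral_left[OF finite_interior_vertices]) (auto simp: harmonic_extension_outside)
  also have "ab\<^sup>2 = (\<Sum>x\<in>?B. (?p x)\<^sup>2)"
    using finite_interior_vertices[of "Suc n" i j] by (simp add: if_distrib[of "\<lambda>z. z\<^sup>2"] cong: if_cong)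
  also have "(\<Sum>x\<in>?B. (?h x)\<^sup>2) + \<dots> \<le> (\<Sum>x\<in>?B. (harmonic_extension (Suc n) i j a b c x)\<^sup>2)"
    unfolding sum.distrib[symmetric]
  proof (rule sum_mono)
    fix x
    have nn: "0 \<le> ?h x" "0 \<le> harmonic_extension n (i + 2^n) j ab b bc x" "0 \<le> harmonic_extension n i (j + 2^n) ac bc c x"
      using Suc.prems m by (auto intro!: harmonic_extension_nonneg)
    have pp: "0 \<le> ?p x" using Suc.prems m by auto
    have "(?h x)\<^sup>2 + (?p x)\<^sup>2 \<le> (?h x + ?p x)\<^sup>2"
      unfolding power2_sum using mult_nonneg_nonneg[OF nn(1) pp] by linarith
    also have "?h x + ?p x \<le> harmonic_extension (Suc n) i j a b c x"
    proof -
      have "0 \<le> (if x = (i, j + 2^n) then ac else 0)"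
        "0 \<le> (if x = (i + 2^n, j + 2^n) then bc else 0)" using Suc.prems m by auto
      then show ?thesis
        unfolding harmonic_extension.simps Let_def mid[symmetric] using nn by linarith
    qed
    then have "(?h x + ?p x)\<^sup>2 \<le> (harmonic_extension (Suc n) i j a b c x)\<^sup>2"
      using nn(1) pp by (intro power_mono add_nonneg_nonneg)
    finally show "(?h x)\<^sup>2 + (?p x)\<^sup>2 \<le> (harmonic_extension (Suc n) i j a b c x)\<^sup>2" .
  qed
  finally show ?case
    by (simp add: distrib_right add.commute del: harmonic_extension.simps interior_vertices.simps)
qed simp


section \<open>Green's identity\<close>

text \<open>The flux out of a corner into its triangle, for the lower left, the lower right and the
  upper corner in turn. Only the two neighbours inside the triangle occur, and they depend on the corner
  but not on the size of the triangle. The fluxes of the two triangles that meet at a vertex add up to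
  four times the Laplacian there.\<close>

definition fluxA :: "(int \<Rightarrow> int \<Rightarrow> real) \<Rightarrow> int \<Rightarrow> int \<Rightarrow> real" where
  "fluxA w i j = 2 * w i j - w (i + 1) j - w i (j + 1)"

definition fluxB :: "(int \<Rightarrow> int \<Rightarrow> real) \<Rightarrow> int \<Rightarrow> int \<Rightarrow> real" where
  "fluxB w i j = 2 * w i j - w (i - 1) j - w (i - 1) (j + 1)"

definition fluxC :: "(int \<Rightarrow> int \<Rightarrow> real) \<Rightarrow> int \<Rightarrow> int \<Rightarrow> real" where
  "fluxC w i j = 2 * w i j - w i (j - 1) - w (i + 1) (j - 1)"

lemma superharmonic_at_neighbours:
  assumes u: "superharmonic_above f u" and vert: "lattice_point i j \<in> SG_verts"
    and edges: "list_all (\<lambda>(k, l). {lattice_point i j, lattice_point k l} \<in> SG_edges) ds"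
    and ds: "distinct ds" "(i, j) \<notin> set ds"
  shows "4 * f (lattice_point i j) + (\<Sum>(k, l)\<leftarrow>ds. u (lattice_point k l)) \<le> 4 * u (lattice_point i j)"
proof -
  let ?F = "case_prod lattice_point ` set ds"
  have inj: "inj_on (case_prod lattice_point) (set ds)"
    by (auto simp: inj_on_def lattice_point_eq_iff)
  have "?F \<subseteq> nbrs (lattice_point i j)"
    using ds(2) edges by (auto simp: lattice_point_eq_iff insert_commute list_all_iff)
  then have "f (lattice_point i j) + (\<Sum>y\<in>?F. u y) / 4 \<le> u (lattice_point i j)"
    using u vert unfolding superharmonic_above_def by auto
  also have "(\<Sum>y\<in>?F. u y) = (\<Sum>(k, l)\<leftarrow>ds. u (lattice_point k l))"
    using ds(1) unfolding sum.reindex[OF inj] by (simp add: sum_list_distinct_conv_sum_set case_prod_unfold)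
  finally show ?thesis by simp
qed

lemma junction_inequalities:
  assumes u: "superharmonic_above f u" and gasket: "gasket_at (Suc n) i j"
  defines "w \<equiv> \<lambda>i j. u (lattice_point i j)"
  shows "4 * f (lattice_point (i + 2^n) j) \<le> fluxB w (i + 2^n) j + fluxA w (i + 2^n) j"
    and "4 * f (lattice_point i (j + 2^n)) \<le> fluxC w i (j + 2^n) + fluxA w i (j + 2^n)"
    and "4 * f (lattice_point (i + 2^n) (j + 2^n)) \<le>
      fluxC w (i + 2^n) (j + 2^n) + fluxB w (i + 2^n) (j + 2^n)"
proof -
  note G = gasket_at_SucD[OF gasket]
  note C1 = gasket_corners[OF G(1)] and C2 = gasket_corners[OF G(2)] and C3 = gasket_corners[OF G(3)]
  show "4 * f (lattice_point (i + 2^n) j) \<le> fluxB w (i + 2^n) j + fluxA w (i + 2^n) j"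
    using superharmonic_at_neighbours[OF u, of "i + 2^n" j "[(i + 2^n - 1, j), (i + 2^n - 1, j + 1),
      (i + 2^n + 1, j), (i + 2^n, j + 1)]"] C1 C2
    by (simp add: fluxA_def fluxB_def w_def)
  show "4 * f (lattice_point i (j + 2^n)) \<le> fluxC w i (j + 2^n) + fluxA w i (j + 2^n)"
    using superharmonic_at_neighbours[OF u, of i "j + 2^n" "[(i, j + 2^n - 1), (i + 1, j + 2^n - 1),
      (i + 1, j + 2^n), (i, j + 2^n + 1)]"] C1 C3
    by (simp add: fluxA_def fluxC_def w_def)
  show "4 * f (lattice_point (i + 2^n) (j + 2^n)) \<le>
      fluxC w (i + 2^n) (j + 2^n) + fluxB w (i + 2^n) (j + 2^n)"
    using superharmonic_at_neighbours[OF u, of "i + 2^n" "j + 2^n" "[(i + 2^n, j + 2^n - 1),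
      (i + 2^n + 1, j + 2^n - 1), (i + 2^n - 1, j + 2^n), (i + 2^n - 1, j + 2^n + 1)]"] C2 C3
    by (simp add: fluxB_def fluxC_def w_def)
qed

text \<open>This is the second Green identity for \<open>u\<close> and the harmonic extension \<open>h\<close>, with \<open>\<Delta>u\<close>
  replaced by its lower bound \<open>f\<close>, which is possible because \<open>h\<close> is nonnegative. The right hand side is the
  sum over the corners of \<open>u\<close> times the flux of \<open>h\<close>; the flux of a harmonic extension decreases by the
  factor \<open>3/5\<close> from one level to the next. In the induction step the fluxes of \<open>h\<close> at the three
  midpoints cancel, which is what the weights two fifths and one fifth achieve, and the fluxes of \<open>u\<close>
  combine to Laplacians.\<close>

lemma green_inequality:
  assumes u: "superharmonic_above f u"
  defines "w \<equiv> \<lambda>i j. u (lattice_point i j)"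
  assumes "gasket_at n i j" "0 \<le> a" "0 \<le> b" "0 \<le> c"
  shows "4 * (\<Sum>x\<in>interior_vertices n i j. harmonic_extension n i j a b c x * f (case_prod lattice_point x)) +
      a * fluxA w i j + b * fluxB w (i + 2^n) j + c * fluxC w i (j + 2^n) \<le>
    (3/5)^n * (w i j * (2*a - b - c) + w (i + 2^n) j * (2*b - a - c) + w i (j + 2^n) * (2*c - a - b))"
  using assms(3-)
proof (induction n arbitrary: i j a b c)
  case 0
  then show ?case by (simp add: fluxA_def fluxB_def fluxC_def algebra_simps)
next
  case (Suc n)
  define ab ac bc where mid: "ab = (2*a + 2*b + c) / 5" "ac = (2*a + b + 2*c) / 5"
    "bc = (a + 2*b + 2*c) / 5"
  have nn: "0 \<le> ab" "0 \<le> ac" "0 \<le> bc" using Suc.prems by (auto simp: mid)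
  note G = gasket_at_SucD[OF Suc.prems(1)]
  note J = junction_inequalities[OF u Suc.prems(1), folded w_def]
  note J' = mult_left_mono[OF J(1) nn(1)] mult_left_mono[OF J(2) nn(2)] mult_left_mono[OF J(3) nn(3)]
  let ?g = "\<lambda>x. f (case_prod lattice_point x)" and ?r = "(3/5::real)^n"
  let ?A = "w i j" and ?B = "w (i + 2^n + 2^n) j" and ?C = "w i (j + 2^n + 2^n)"
  let ?AB = "w (i + 2^n) j" and ?AC = "w i (j + 2^n)" and ?BC = "w (i + 2^n) (j + 2^n)"
  have pow: "i + 2 ^ Suc n = i + 2^n + 2^n" "j + 2 ^ Suc n = j + 2^n + 2^n" by simp_all
  have 1: "4 * (\<Sum>x\<in>interior_vertices n i j. harmonic_extension n i j a ab ac x * ?g x) +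
      a * fluxA w i j + ab * fluxB w (i + 2^n) j + ac * fluxC w i (j + 2^n) \<le>
      ?r * (?A * (2*a - ab - ac) + ?AB * (2*ab - a - ac) + ?AC * (2*ac - a - ab))"
    using Suc.IH[OF G(1) Suc.prems(2) nn(1,2)] .
  have 2: "4 * (\<Sum>x\<in>interior_vertices n (i + 2^n) j. harmonic_extension n (i + 2^n) j ab b bc x * ?g x) +
      ab * fluxA w (i + 2^n) j + b * fluxB w (i + 2^n + 2^n) j + bc * fluxC w (i + 2^n) (j + 2^n) \<le>
      ?r * (?AB * (2*ab - b - bc) + ?B * (2*b - ab - bc) + ?BC * (2*bc - ab - b))"
    using Suc.IH[OF G(2) nn(1) Suc.prems(3) nn(3)] .
  have 3: "4 * (\<Sum>x\<in>interior_vertices n i (j + 2^n). harmonic_extension n i (j + 2^n) ac bc c x * ?g x) +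
      ac * fluxA w i (j + 2^n) + bc * fluxB w (i + 2^n) (j + 2^n) + c * fluxC w i (j + 2^n + 2^n) \<le>
      ?r * (?AC * (2*ac - bc - c) + ?BC * (2*bc - ac - c) + ?C * (2*c - ac - bc))"
    using Suc.IH[OF G(3) nn(2,3) Suc.prems(4)] .
  \<comment> \<open>The coefficients of the values at the three midpoints vanish.\<close>
  have flux: "?A * (2*a - ab - ac) + ?AB * (2*ab - a - ac) + ?AC * (2*ac - a - ab) +
      (?AB * (2*ab - b - bc) + ?B * (2*b - ab - bc) + ?BC * (2*bc - ab - b)) +
      (?AC * (2*ac - bc - c) + ?BC * (2*bc - ac - c) + ?C * (2*c - ac - bc)) =
      3/5 * (?A * (2*a - b - c) + ?B * (2*b - a - c) + ?C * (2*c - a - b))"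
    by (simp add: mid field_simps)
  have "4 * (\<Sum>x\<in>interior_vertices (Suc n) i j. harmonic_extension (Suc n) i j a b c x * ?g x) +
      a * fluxA w i j + b * fluxB w (i + 2^n + 2^n) j + c * fluxC w i (j + 2^n + 2^n) \<le>
    ?r * (?A * (2*a - ab - ac) + ?AB * (2*ab - a - ac) + ?AC * (2*ac - a - ab)) +
    ?r * (?AB * (2*ab - b - bc) + ?B * (2*b - ab - bc) + ?BC * (2*bc - ab - b)) +
    ?r * (?AC * (2*ac - bc - c) + ?BC * (2*bc - ac - c) + ?C * (2*c - ac - bc))"
    unfolding sum_harmonic_extension_Suc mid[symmetric] using 1 2 3 J'
    by (simp only: distrib_left mult.left_commute[of _ 4] case_prod_conv)
  also have "\<dots> = (3/5)^Suc n * (?A * (2*a - b - c) + ?B * (2*b - a - c) + ?C * (2*c - a - b))"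
    unfolding distrib_left[of ?r, symmetric] flux by simp
  finally show ?case unfolding pow .
qed

text \<open>With boundary values 1 at the origin and 0 at the far corners, the fluxes of \<open>u\<close> at the far
  corners drop out, and the values of \<open>u\<close> there contribute a nonpositive term on the right. The
  remaining term on the right is at most twice the value of \<open>u\<close> at the origin. It cancels in the flux
  there, which leaves the values at two neighbours.\<close>

lemma green_from_origin:
  assumes u: "superharmonic_above f u" and nonneg: "\<And>x. 0 \<le> u x"
  shows "4 * (\<Sum>x\<in>interior_vertices n 0 0. harmonic_extension n 0 0 1 0 0 x * f (case_prod lattice_point x)) \<le>
    u (lattice_point 1 0) + u (lattice_point 0 1)"
proof -
  let ?w = "\<lambda>i j. u (lattice_point i j)"
  have "(3/5)^n * (?w 0 0 * 2 - ?w (2^n) 0 - ?w 0 (2^n)) \<le> (3/5)^n * (?w 0 0 * 2)"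
    using nonneg[of "lattice_point (2^n) 0"] nonneg[of "lattice_point 0 (2^n)"]
    by (intro mult_left_mono) simp_all
  also have "\<dots> \<le> 1 * (?w 0 0 * 2)"
    using nonneg[of "lattice_point 0 0"] by (intro mult_right_mono power_le_one) auto
  finally show ?thesis
    using green_inequality[OF u gasket_at_origin, of 1 0 0 n] by (simp add: fluxA_def algebra_simps)
qed

text \<open>The sub-triangle at the origin has boundary values 1, 2/5 and 2/5, so the values there do not
  get small however large the triangle is. This is where recurrence of the gasket enters.\<close>

lemma sum_harmonic_extension_square_at_top:
  "filterlim (\<lambda>n. \<Sum>x\<in>interior_vertices n 0 0. (harmonic_extension n 0 0 1 0 0 x)\<^sup>2) at_top sequentially"
proof -
  have "real n * (2/5)\<^sup>2 \<le> (\<Sum>x\<in>interior_vertices (Suc n) 0 0. (harmonic_extension (Suc n) 0 0 1 0 0 x)\<^sup>2)" for n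
  proof -
    have "real n * (2/5)\<^sup>2 \<le> (\<Sum>x\<in>interior_vertices n 0 0. (harmonic_extension n 0 0 1 (2/5) (2/5) x)\<^sup>2)"
      by (rule sum_harmonic_extension_square_ge) auto
    also have "\<dots> \<le> (\<Sum>x\<in>interior_vertices n 0 0. (harmonic_extension (Suc n) 0 0 1 0 0 x)\<^sup>2)"
      by (intro sum_mono power_mono) (auto simp: Let_def harmonic_extension_nonneg intro!: add_nonneg_nonneg)
    also have "\<dots> \<le> (\<Sum>x\<in>interior_vertices (Suc n) 0 0. (harmonic_extension (Suc n) 0 0 1 0 0 x)\<^sup>2)"
      by (intro sum_mono2 finite_interior_vertices) auto
    finally show ?thesis .
  qed
  moreover have "filterlim (\<lambda>n. real n * (2/5)\<^sup>2) at_top sequentially"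
    by (intro filterlim_at_top_mult_tendsto_pos[OF tendsto_const _ filterlim_real_sequentially]) simp
  ultimately have "filterlim (\<lambda>n. \<Sum>x\<in>interior_vertices (Suc n) 0 0. (harmonic_extension (Suc n) 0 0 1 0 0 x)\<^sup>2) at_top sequentially"
    by (intro filterlim_at_top_mono[where g = "\<lambda>n. \<Sum>x\<in>interior_vertices (Suc n) 0 0. (harmonic_extension (Suc n) 0 0 1 0 0 x)\<^sup>2"]) auto
  then show ?thesis by (subst (asm) filterlim_sequentially_Suc)
qed


section \<open>Almost sure instability\<close>

theorem proposition4p5:
  fixes M :: "'a measure" and \<sigma> :: "point \<Rightarrow> 'a \<Rightarrow> real"
  assumes "prob_space M"
    and "prob_space.indep_vars M (\<lambda>_. borel) \<sigma> SG_verts"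
    and "\<And>x. x \<in> SG_verts \<Longrightarrow> distr M borel (\<sigma> x) = distr M borel (\<sigma> (0, 0))"
    and "integrable M (\<sigma> (0, 0))"
    and "integrable M (\<lambda>\<omega>. (\<sigma> (0, 0) \<omega>)\<^sup>2)"
    and "prob_space.expectation M (\<sigma> (0, 0)) \<ge> 1"
    and "prob_space.variance M (\<sigma> (0, 0)) > 0"
  shows "AE \<omega> in M. \<not> stabilizes (\<lambda>x. \<sigma> x \<omega>)"
proof -
  interpret prob_space M by fact
  define \<mu> where "\<mu> = expectation (\<sigma> (0, 0))"
  define D where "D = distr M borel (\<lambda>\<omega>. \<sigma> (0, 0) \<omega> - \<mu>)"
  have o: "(0, 0) \<in> SG_verts"
    using gasket_corners(1)[OF gasket_at_origin] by (simp add: lattice_point_def)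
  have rv: "\<sigma> x \<in> borel_measurable M" if "x \<in> SG_verts" for x
    using assms(2) that unfolding indep_vars_def2 by blast
  note [measurable] = rv[OF o]
  have sq: "integrable M (\<lambda>\<omega>. (\<sigma> (0, 0) \<omega> - \<mu>)\<^sup>2)"
    using assms(4,5) unfolding power2_diff by simp
  interpret iid: centered_iid M "\<lambda>x \<omega>. \<sigma> x \<omega> - \<mu>" SG_verts D
  proof (intro centered_iid.intro centered_iid_axioms.intro)
    show "prob_space M" by fact
    show "indep_vars (\<lambda>_. borel) (\<lambda>x \<omega>. \<sigma> x \<omega> - \<mu>) SG_verts"
      by (rule indep_vars_compose2[OF assms(2)]) auto
    show "distr M borel (\<lambda>\<omega>. \<sigma> x \<omega> - \<mu>) = D" if x: "x \<in> SG_verts" for x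
    proof -
      have shift: "distr M borel (\<lambda>\<omega>. \<sigma> y \<omega> - \<mu>) = distr (distr M borel (\<sigma> y)) borel (\<lambda>z. z - \<mu>)"
        if "y \<in> SG_verts" for y
        using rv[OF that] by (subst distr_distr) (auto simp: comp_def)
      show ?thesis unfolding D_def shift[OF x] shift[OF o] assms(3)[OF x] ..
    qed
    show "real_distribution D" unfolding D_def by (rule real_distribution_distr) measurable
    show "integrable D (\<lambda>x. x\<^sup>2)" using sq by (simp add: D_def integrable_distr_eq)
    show "(\<integral>x. x \<partial>D) = 0"
      using assms(4) by (simp add: D_def integral_distr prob_space \<mu>_def)
    show "(\<integral>x. x\<^sup>2 \<partial>D) > 0" using assms(7) by (simp add: D_def integral_distr \<mu>_def)
  qed

  let ?p = "case_prod lattice_point"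
  let ?h = "\<lambda>n. harmonic_extension n 0 0 1 0 0"
  define B where "B n = ?p ` interior_vertices n 0 0" for n
  define a where "a n x = ?h n (inv ?p x)" for n x
  have inj: "inj ?p" by (auto simp: inj_def lattice_point_eq_iff)
  have sum_B: "(\<Sum>x\<in>B n. f x) = (\<Sum>x\<in>interior_vertices n 0 0. f (?p x))" for f :: "point \<Rightarrow> real" and n
    unfolding B_def using inj by (subst sum.reindex) (auto intro: inj_on_subset)
  have a_p: "a n (?p x) = ?h n x" for n x
    using inj by (simp add: a_def inv_f_f del: case_prod_conv split_paired_All)
  have "AE \<omega> in M. \<forall>K. \<exists>n. K < (\<Sum>x\<in>B n. a n x * (\<sigma> x \<omega> - \<mu>))"
  proof (rule iid.weighted_sums_unbounded)
    show "finite (B n)" "B n \<subseteq> SG_verts" for n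
      using finite_interior_vertices interior_vertices_in_SG_verts[OF gasket_at_origin]
      by (auto simp: B_def)
    show "\<bar>a n x\<bar> \<le> 1" for n x
      using harmonic_extension_nonneg[of 1 0 0] harmonic_extension_le_1[of 1 0 0] by (simp add: a_def)
    show "filterlim (\<lambda>n. \<Sum>x\<in>B n. (a n x)\<^sup>2) at_top sequentially"
      unfolding sum_B a_p by (rule sum_harmonic_extension_square_at_top)
  qed
  then show ?thesis
  proof (rule AE_mp, intro AE_I2 impI notI)
    fix \<omega>
    assume unbounded: "\<forall>K. \<exists>n. K < (\<Sum>x\<in>B n. a n x * (\<sigma> x \<omega> - \<mu>))"
      and "stabilizes (\<lambda>x. \<sigma> x \<omega>)"
    then obtain u where u: "\<And>x. 0 \<le> u x" "superharmonic_above (\<lambda>x. \<sigma> x \<omega> - 1) u"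
      using stabilizes_imp_superharmonic by blast
    obtain n where n: "(u (lattice_point 1 0) + u (lattice_point 0 1)) / 4 <
        (\<Sum>x\<in>B n. a n x * (\<sigma> x \<omega> - \<mu>))"
      using unbounded by blast
    also have "\<dots> \<le> (\<Sum>x\<in>interior_vertices n 0 0. ?h n x * (\<sigma> (?p x) \<omega> - 1))"
      unfolding sum_B a_p using assms(6)
      by (intro sum_mono mult_left_mono) (auto simp: \<mu>_def harmonic_extension_nonneg)
    finally show False using green_from_origin[OF u(2,1), of n] by simp
  qed
qed

end
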